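(* Let $K$ be a field, $\Lambda$ a $k$-graph and $(\Delta,\alpha)$ a representation $k$-graph for $\Lambda$. Then the following are equivalent. (i) The $\mathrm{KP}(\Lambda)$-module $V_{(\Delta,\alpha)}$ is simple. (ii) For any $x\in V_{(\Delta,\alpha)}\setminus\{0\}$ there is an $a\in\mathrm{KP}(\Lambda)$ such that $a.x\in\Delta^{\mathrm{ob}}$. (iii) For any $x\in V_{(\Delta,\alpha)}\setminus\{0\}$ there are a $k\in K$ and a $p\in\mathrm{Walk}(\Lambda)$ such that $kp.x\in\Delta^{\mathrm{ob}}$. (iv) $(\Delta,\alpha)$ is irreducible.
   Context: **$k$-graphs.** $\mathbb N=\{0,1,2,\dots\}$; for a positive integer $k$ the additive monoid $\mathbb N^k$ is viewed as a category with one object. A $k$-graph is a small category $\Lambda$ (the symbol $\Lambda$ also denotes its set of morphisms, $\Lambda^{\mathrm{ob}}$ its set of objects or vertices, $r,s$ the range and source maps) together with a functor $d:\Lambda\to\mathbb N^k$ (degree map) such that: if $d(\lambda)=m+n$ with $m,n\in\mathbb N^k$, there are unique $\mu,\nu\in\Lambda$ with $d(\mu)=m$, $d(\nu)=n$, $\lambda=\mu\circ\nu$. For $u,v\in\Lambda^{\mathrm{ob}}$, $n\in\mathbb N^k$: $u\Lambda=r^{-1}(u)$, $\Lambda v=s^{-1}(v)$, $u\Lambda v=u\Lambda\cap\Lambda v$, $u\Lambda^n=u\Lambda\cap d^{-1}(n)$. A morphism of $k$-graphs is a degree-preserving functor. Standing assumption: all $k$-graphs are nonempty ($\Lambda^{\mathrm{ob}}\ne\emptyset$),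 connected (the equivalence relation on $\Lambda^{\mathrm{ob}}$ generated by $\{(u,v): u\Lambda v\neq\emptyset\}$ is all of $\Lambda^{\mathrm{ob}}\times\Lambda^{\mathrm{ob}}$), row-finite (each $v\Lambda^n$ is finite) and without sources (each $v\Lambda^n$ is nonempty). **Walks.** Let $E_d$ be the directed graph with vertex set $\Lambda^{\mathrm{ob}}$, with one edge from $s(\lambda)$ to $r(\lambda)$ for each morphism $\lambda$ (identities included) and, for each non-identity $\lambda$, an extra edge $\lambda^*$ from $r(\lambda)$ to $s(\lambda)$. A walk in $\Lambda$ is a nonempty finite path $p=e_n\cdots e_1$ in $E_d$ ($s(e_i)=r(e_{i-1})$), with $s(p)=s(e_1)$, $r(p)=r(e_n)$. $\mathrm{Walk}(\Lambda)$ is the set of walks and $\mathrm{Walk}_u(\Lambda)$ the subset of walks starting in $u$. A $k$-graph morphism $\alpha$ induces a map on walks (with $\lambda^*\mapsto\alpha(\lambda)^*$), again denoted $\alpha$. **Representation $k$-graphs.** A representation $k$-graph for $\Lambda$ is a pair $(\Delta,\alpha)$ of a $k$-graph $\Delta$ and a $k$-graph morphism $\alpha:\Delta\to\Lambda$ such that for every $v\in\Delta^{\mathrm{ob}}$: (i) $\alpha$ maps $\Delta v$ bijectively onto $\Lambda\alpha(v)$; (ii) $v\Delta^n$ is a singleton for every $n\in\mathbb N^k$. $(\Delta,\alpha)$ is irreducible if $\alpha(\mathrm{Walk}_u(\Delta))\neq\alpha(\mathrm{Walk}_v(\Delta))$ for all $u\neq v$ in $\Delta^{\mathrm{ob}}$.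 **Kumjian-Pask algebra.** $K$-algebras are associative, not necessarily commutative or unital. For $\lambda\in\Lambda$ of nonzero degree let $\lambda^*$ be a new symbol; for $\lambda$ of degree $0$ put $\lambda^*:=\lambda$. $\mathrm{KP}(\Lambda)$ is the $K$-algebra presented by generators $\Lambda\cup\Lambda^*$ and relations: (KP1) $\lambda\mu=\delta_{s(\lambda),r(\mu)}(\lambda\circ\mu)$ for $\lambda,\mu\in\Lambda$; (KP2) $\mu^*\lambda^*=\delta_{s(\lambda),r(\mu)}(\lambda\circ\mu)^*$ for $\lambda,\mu\in\Lambda$; (KP3) $\lambda^*\mu=\delta_{\lambda,\mu}1_{s(\lambda)}$ for $\lambda,\mu\in\Lambda$ with $d(\lambda)=d(\mu)$; (KP4) $\sum_{\lambda\in v\Lambda^n}\lambda\lambda^*=1_v$ for $v\in\Lambda^{\mathrm{ob}}$, $n\in\mathbb N^k$. Walks in $\Lambda$ are viewed as monomials in $\mathrm{KP}(\Lambda)$. **The module $V_{(\Delta,\alpha)}$.** It is the $K$-vector space with basis $\Delta^{\mathrm{ob}}$, with the left $\mathrm{KP}(\Lambda)$-action determined, for $\lambda\in\Lambda$ and $v\in\Delta^{\mathrm{ob}}$, by: $\lambda.v=r(\delta)$ if there is a (necessarily unique) $\delta\in\Delta v$ with $\alpha(\delta)=\lambda$, and $\lambda.v=0$ otherwise; $\lambda^*.v=s(\delta)$ if there is a (necessarily unique) $\delta\in v\Delta$ with $\alpha(\delta)=\lambda$, and $\lambda^*.v=0$ otherwise. The set $\Delta^{\mathrm{ob}}$ is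 regarded as a subset of $V_{(\Delta,\alpha)}$. *)

theory Defs
  imports "HOL-Analysis.Finite_Cartesian_Product" "HOL-Library.Poly_Mapping"
begin

section \<open>k-graphs\<close>

text \<open>The rank is the cardinality of the finite index type \<open>'k\<close>; degrees live in \<open>nat ^ 'k\<close>.
  \<open>cmp\<close> is composition in the order \<open>cmp \<lambda> \<mu> = \<lambda> \<circ> \<mu>\<close>, defined when \<open>src \<lambda> = ran \<mu>\<close>.\<close>

record ('o, 'm, 'k::finite) kgraph_data =
  obj :: "'o set"
  mor :: "'m set"
  src :: "'m \<Rightarrow> 'o"
  ran :: "'m \<Rightarrow> 'o"
  idm :: "'o \<Rightarrow> 'm"
  cmp :: "'m \<Rightarrow> 'm \<Rightarrow> 'm"
  deg :: "'m \<Rightarrow> nat ^ 'k"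

locale kgraph =
  fixes L :: "('o, 'm, 'k::finite) kgraph_data"
  assumes src_obj: "f \<in> mor L \<Longrightarrow> src L f \<in> obj L"
    and ran_obj: "f \<in> mor L \<Longrightarrow> ran L f \<in> obj L"
    and idm_mor: "v \<in> obj L \<Longrightarrow> idm L v \<in> mor L"
    and src_idm: "v \<in> obj L \<Longrightarrow> src L (idm L v) = v"
    and ran_idm: "v \<in> obj L \<Longrightarrow> ran L (idm L v) = v"
    and cmp_mor: "\<lbrakk>f \<in> mor L; g \<in> mor L; src L f = ran L g\<rbrakk> \<Longrightarrow> cmp L f g \<in> mor L"
    and src_cmp: "\<lbrakk>f \<in> mor L; g \<in> mor L; src L f = ran L g\<rbrakk> \<Longrightarrow> src L (cmp L f g) = src L g"
    and ran_cmp: "\<lbrakk>f \<in> mor L; g \<in> mor L; src L f = ran L g\<rbrakk> \<Longrightarrow> ran L (cmp L f g) = ran L f"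
    and cmp_idm_left: "f \<in> mor L \<Longrightarrow> cmp L (idm L (ran L f)) f = f"
    and cmp_idm_right: "f \<in> mor L \<Longrightarrow> cmp L f (idm L (src L f)) = f"
    and cmp_assoc: "\<lbrakk>f \<in> mor L; g \<in> mor L; h \<in> mor L; src L f = ran L g; src L g = ran L h\<rbrakk>
        \<Longrightarrow> cmp L (cmp L f g) h = cmp L f (cmp L g h)"
    and deg_idm: "v \<in> obj L \<Longrightarrow> deg L (idm L v) = 0"
    and deg_cmp: "\<lbrakk>f \<in> mor L; g \<in> mor L; src L f = ran L g\<rbrakk>
        \<Longrightarrow> deg L (cmp L f g) = deg L f + deg L g"
    and factorization: "\<lbrakk>f \<in> mor L; deg L f = m + n\<rbrakk>
        \<Longrightarrow> \<exists>!(g, h). g \<in> mor L \<and> h \<in> mor L \<and> deg L g = m \<and> deg L h = n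
              \<and> src L g = ran L h \<and> f = cmp L g h"

text \<open>\<open>v\<Lambda>\<^sup>n\<close> and \<open>\<Lambda>v\<close>.\<close>

definition into_deg :: "('o, 'm, 'k::finite) kgraph_data \<Rightarrow> 'o \<Rightarrow> nat ^ 'k \<Rightarrow> 'm set" where
  "into_deg L v n = {f \<in> mor L. ran L f = v \<and> deg L f = n}"

definition out_of :: "('o, 'm, 'k::finite) kgraph_data \<Rightarrow> 'o \<Rightarrow> 'm set" where
  "out_of L v = {f \<in> mor L. src L f = v}"

text \<open>The standing assumptions: nonempty, connected, row-finite, without sources.\<close>

locale std_kgraph = kgraph +
  assumes nonempty: "obj L \<noteq> {}"
    and connected: "\<lbrakk>u \<in> obj L; v \<in> obj L\<rbrakk>
        \<Longrightarrow> equivclp (\<lambda>a b. \<exists>f \<in> mor L. ran L f = a \<and> src L f = b) u v"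
    and row_finite: "v \<in> obj L \<Longrightarrow> finite (into_deg L v n)"
    and no_sources: "v \<in> obj L \<Longrightarrow> into_deg L v n \<noteq> {}"

record ('o, 'm, 'p, 'n) kgraph_map =
  omap :: "'o \<Rightarrow> 'p"
  mmap :: "'m \<Rightarrow> 'n"

locale kgraph_morphism = dom: kgraph D + cod: kgraph L
  for D :: "('o, 'm, 'k::finite) kgraph_data" and L :: "('p, 'n, 'k) kgraph_data" +
  fixes \<alpha> :: "('o, 'm, 'p, 'n) kgraph_map"
  assumes omap_obj: "v \<in> obj D \<Longrightarrow> omap \<alpha> v \<in> obj L"
    and mmap_mor: "f \<in> mor D \<Longrightarrow> mmap \<alpha> f \<in> mor L"
    and mmap_src: "f \<in> mor D \<Longrightarrow> src L (mmap \<alpha> f) = omap \<alpha> (src D f)"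
    and mmap_ran: "f \<in> mor D \<Longrightarrow> ran L (mmap \<alpha> f) = omap \<alpha> (ran D f)"
    and mmap_idm: "v \<in> obj D \<Longrightarrow> mmap \<alpha> (idm D v) = idm L (omap \<alpha> v)"
    and mmap_cmp: "\<lbrakk>f \<in> mor D; g \<in> mor D; src D f = ran D g\<rbrakk>
        \<Longrightarrow> mmap \<alpha> (cmp D f g) = cmp L (mmap \<alpha> f) (mmap \<alpha> g)"
    and mmap_deg: "f \<in> mor D \<Longrightarrow> deg L (mmap \<alpha> f) = deg D f"

locale representation_kgraph = kgraph_morphism D L \<alpha> + dom: std_kgraph D
  for D :: "('o, 'm, 'k::finite) kgraph_data" and L :: "('p, 'n, 'k) kgraph_data"
    and \<alpha> :: "('o, 'm, 'p, 'n) kgraph_map" +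
  assumes bij_out: "v \<in> obj D \<Longrightarrow> bij_betw (mmap \<alpha>) (out_of D v) (out_of L (omap \<alpha> v))"
    and singleton_into: "v \<in> obj D \<Longrightarrow> is_singleton (into_deg D v n)"


section \<open>Walks\<close>

text \<open>\<open>Real \<lambda>\<close> stands for \<open>\<lambda>\<close>, and \<open>Ghost \<lambda>\<close> for the new symbol \<open>\<lambda>\<^sup>*\<close>, both as edges and as
  generators of the Kumjian-Pask algebra. A walk \<open>e\<^sub>n \<dots> e\<^sub>1\<close> is the list \<open>[e\<^sub>n, \<dots>, e\<^sub>1]\<close>.\<close>

datatype 'm letter = Real 'm | Ghost 'm

definition walk_edges :: "('o, 'm, 'k::finite) kgraph_data \<Rightarrow> 'm letter set" where
  "walk_edges L = Real ` mor L \<union> Ghost ` (mor L - idm L ` obj L)"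

fun edge_src :: "('o, 'm, 'k::finite) kgraph_data \<Rightarrow> 'm letter \<Rightarrow> 'o" where
  "edge_src L (Real f) = src L f"
| "edge_src L (Ghost f) = ran L f"

fun edge_ran :: "('o, 'm, 'k::finite) kgraph_data \<Rightarrow> 'm letter \<Rightarrow> 'o" where
  "edge_ran L (Real f) = ran L f"
| "edge_ran L (Ghost f) = src L f"

definition walks :: "('o, 'm, 'k::finite) kgraph_data \<Rightarrow> 'm letter list set" where
  "walks L = {p. p \<noteq> [] \<and> set p \<subseteq> walk_edges L \<and>
                 successively (\<lambda>e e'. edge_src L e = edge_ran L e') p}"

definition walks_from :: "('o, 'm, 'k::finite) kgraph_data \<Rightarrow> 'o \<Rightarrow> 'm letter list set" where
  "walks_from L u = {p \<in> walks L. edge_src L (last p) = u}"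

definition walk_map :: "('o, 'm, 'p, 'n) kgraph_map \<Rightarrow> 'm letter list \<Rightarrow> 'n letter list" where
  "walk_map \<alpha> = map (map_letter (mmap \<alpha>))"

definition irreducible_rep ::
    "('o, 'm, 'k::finite) kgraph_data \<Rightarrow> ('o, 'm, 'p, 'n) kgraph_map \<Rightarrow> bool" where
  "irreducible_rep D \<alpha> \<longleftrightarrow>
     (\<forall>u \<in> obj D. \<forall>v \<in> obj D. u \<noteq> v \<longrightarrow> walk_map \<alpha> ` walks_from D u \<noteq> walk_map \<alpha> ` walks_from D v)"


section \<open>Finitely supported functions as vectors\<close>

definition pscale :: "'c::semiring_0 \<Rightarrow> ('a \<Rightarrow>\<^sub>0 'c) \<Rightarrow> ('a \<Rightarrow>\<^sub>0 'c)" where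
  "pscale c x = Poly_Mapping.map ((*) c) x"

lemma lookup_pscale [simp]: "Poly_Mapping.lookup (pscale c x) i = c * Poly_Mapping.lookup x i"
  by (simp add: pscale_def Poly_Mapping.map.rep_eq when_def)

lemma vector_space_pscale: "vector_space (pscale :: 'c::field \<Rightarrow> ('a \<Rightarrow>\<^sub>0 'c) \<Rightarrow> _)"
  by unfold_locales (auto intro!: poly_mapping_eqI simp: lookup_add algebra_simps)

text \<open>The linear extension of a map defined on basis vectors.\<close>

definition lin_ext :: "('a \<Rightarrow> ('b \<Rightarrow>\<^sub>0 'c)) \<Rightarrow> ('a \<Rightarrow>\<^sub>0 'c) \<Rightarrow> ('b \<Rightarrow>\<^sub>0 'c::semiring_0)" where
  "lin_ext \<phi> x = (\<Sum>v \<in> Poly_Mapping.keys x. pscale (Poly_Mapping.lookup x v) (\<phi> v))"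


section \<open>Algebras and modules\<close>

record ('c, 'a) alg_data =
  carr :: "'a set"
  azero :: "'a"
  aadd :: "'a \<Rightarrow> 'a \<Rightarrow> 'a"
  amult :: "'a \<Rightarrow> 'a \<Rightarrow> 'a"
  ascale :: "'c \<Rightarrow> 'a \<Rightarrow> 'a"

text \<open>A left module over a not necessarily unital algebra is a vector space with a bilinear
  associative action, and its submodules are the invariant linear subspaces. As usual without a
  unit, simplicity asks that the action be nonzero, which is stronger than \<open>V \<noteq> {0}\<close> in general.\<close>

definition left_module ::
    "('c::field, 'a) alg_data \<Rightarrow> ('c \<Rightarrow> 'v \<Rightarrow> 'v::ab_group_add) \<Rightarrow> 'v set \<Rightarrow> ('a \<Rightarrow> 'v \<Rightarrow> 'v) \<Rightarrow> bool" where
  "left_module A scl V act \<longleftrightarrow>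
     vector_space scl \<and> module.subspace scl V \<and>
     (\<forall>a \<in> carr A. \<forall>x \<in> V. act a x \<in> V) \<and>
     (\<forall>a \<in> carr A. \<forall>x \<in> V. \<forall>y \<in> V. act a (x + y) = act a x + act a y) \<and>
     (\<forall>a \<in> carr A. \<forall>b \<in> carr A. \<forall>x \<in> V. act (aadd A a b) x = act a x + act b x) \<and>
     (\<forall>a \<in> carr A. \<forall>b \<in> carr A. \<forall>x \<in> V. act (amult A a b) x = act a (act b x)) \<and>
     (\<forall>c. \<forall>a \<in> carr A. \<forall>x \<in> V. act (ascale A c a) x = scl c (act a x) \<and> act a (scl c x) = scl c (act a x))"

definition simple_module ::
    "('c::field, 'a) alg_data \<Rightarrow> ('c \<Rightarrow> 'v \<Rightarrow> 'v::ab_group_add) \<Rightarrow> 'v set \<Rightarrow> ('a \<Rightarrow> 'v \<Rightarrow> 'v) \<Rightarrow> bool" where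
  "simple_module A scl V act \<longleftrightarrow>
     left_module A scl V act \<and>
     (\<exists>a \<in> carr A. \<exists>x \<in> V. act a x \<noteq> 0) \<and>
     (\<forall>W \<subseteq> V. module.subspace scl W \<and> (\<forall>a \<in> carr A. \<forall>x \<in> W. act a x \<in> W) \<longrightarrow> W = {0} \<or> W = V)"


section \<open>Algebras presented by generators and relations\<close>

text \<open>Words form the free monoid; it is wrapped in a type of its own so that the convolution
  product of \<open>poly_mapping\<close> becomes the product of the free algebra.\<close>

datatype 'g gword = Word (letters: "'g list")

instantiation gword :: (type) monoid_add
begin

definition zero_gword :: "'a gword" where "0 = Word []"

definition plus_gword :: "'a gword \<Rightarrow> 'a gword \<Rightarrow> 'a gword" where
  "v + w = Word (letters v @ letters w)"

instance
  by standard (auto simp: zero_gword_def plus_gword_def)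

end

definition monomial :: "'g list \<Rightarrow> ('g gword \<Rightarrow>\<^sub>0 'c::field)" where
  "monomial gs = Poly_Mapping.single (Word gs) 1"

text \<open>Only nonempty words are allowed: the free algebra is nonunital.\<close>

definition free_alg :: "'g set \<Rightarrow> ('g gword \<Rightarrow>\<^sub>0 'c::field) set" where
  "free_alg X = {f. \<forall>w \<in> Poly_Mapping.keys f. letters w \<noteq> [] \<and> set (letters w) \<subseteq> X}"

inductive_set gen_ideal :: "'g set \<Rightarrow> ('g gword \<Rightarrow>\<^sub>0 'c::field) set \<Rightarrow> ('g gword \<Rightarrow>\<^sub>0 'c) set"
  for X :: "'g set" and R :: "('g gword \<Rightarrow>\<^sub>0 'c) set" where
  gen: "r \<in> R \<Longrightarrow> r \<in> gen_ideal X R"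
| zero: "0 \<in> gen_ideal X R"
| add: "\<lbrakk>a \<in> gen_ideal X R; b \<in> gen_ideal X R\<rbrakk> \<Longrightarrow> a + b \<in> gen_ideal X R"
| scale: "a \<in> gen_ideal X R \<Longrightarrow> pscale c a \<in> gen_ideal X R"
| mult_left: "\<lbrakk>f \<in> free_alg X; a \<in> gen_ideal X R\<rbrakk> \<Longrightarrow> f * a \<in> gen_ideal X R"
| mult_right: "\<lbrakk>f \<in> free_alg X; a \<in> gen_ideal X R\<rbrakk> \<Longrightarrow> a * f \<in> gen_ideal X R"

definition ideal_cong ::
    "'g set \<Rightarrow> ('g gword \<Rightarrow>\<^sub>0 'c::field) set \<Rightarrow> (('g gword \<Rightarrow>\<^sub>0 'c) \<times> ('g gword \<Rightarrow>\<^sub>0 'c)) set" where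
  "ideal_cong X R = {(f, g). f \<in> free_alg X \<and> g \<in> free_alg X \<and> f - g \<in> gen_ideal X R}"

definition presented_alg ::
    "'g set \<Rightarrow> ('g gword \<Rightarrow>\<^sub>0 'c::field) set \<Rightarrow> ('c, ('g gword \<Rightarrow>\<^sub>0 'c) set) alg_data" where
  "presented_alg X R = \<lparr>
     carr = free_alg X // ideal_cong X R,
     azero = ideal_cong X R `` {0},
     aadd = (\<lambda>a b. \<Union>f \<in> a. \<Union>g \<in> b. ideal_cong X R `` {f + g}),
     amult = (\<lambda>a b. \<Union>f \<in> a. \<Union>g \<in> b. ideal_cong X R `` {f * g}),
     ascale = (\<lambda>c a. \<Union>f \<in> a. ideal_cong X R `` {pscale c f}) \<rparr>"


section \<open>The Kumjian-Pask algebra\<close>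

definition star :: "('o, 'm, 'k::finite) kgraph_data \<Rightarrow> 'm \<Rightarrow> 'm letter" where
  "star L f = (if deg L f = 0 then Real f else Ghost f)"

definition kp_gens :: "('o, 'm, 'k::finite) kgraph_data \<Rightarrow> 'm letter set" where
  "kp_gens L = Real ` mor L \<union> star L ` mor L"

text \<open>A relation \<open>a = b\<close> is represented by the element \<open>a - b\<close> of the free algebra.\<close>

definition kp_rels :: "('o, 'm, 'k::finite) kgraph_data \<Rightarrow> ('m letter gword \<Rightarrow>\<^sub>0 'c::field) set" where
  "kp_rels L =
     {monomial [Real f, Real g] - (if src L f = ran L g then monomial [Real (cmp L f g)] else 0)
        | f g. f \<in> mor L \<and> g \<in> mor L}
   \<union> {monomial [star L g, star L f] - (if src L f = ran L g then monomial [star L (cmp L f g)] else 0)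
        | f g. f \<in> mor L \<and> g \<in> mor L}
   \<union> {monomial [star L f, Real g] - (if f = g then monomial [Real (idm L (src L f))] else 0)
        | f g. f \<in> mor L \<and> g \<in> mor L \<and> deg L f = deg L g}
   \<union> {(\<Sum>f \<in> into_deg L v n. monomial [Real f, star L f]) - monomial [Real (idm L v)]
        | v n. v \<in> obj L}"

definition KP :: "'c::field itself \<Rightarrow> ('o, 'm, 'k::finite) kgraph_data
    \<Rightarrow> ('c, ('m letter gword \<Rightarrow>\<^sub>0 'c) set) alg_data" where
  "KP _ L = presented_alg (kp_gens L) (kp_rels L)"

definition kp_monomial :: "'c::field itself \<Rightarrow> ('o, 'm, 'k::finite) kgraph_data
    \<Rightarrow> 'm letter list \<Rightarrow> ('m letter gword \<Rightarrow>\<^sub>0 'c) set" where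
  "kp_monomial _ L p = ideal_cong (kp_gens L) (kp_rels L) `` {monomial p}"


section \<open>The module of a representation k-graph\<close>

definition rep_space :: "'c::field itself \<Rightarrow> ('o, 'm, 'k::finite) kgraph_data \<Rightarrow> ('o \<Rightarrow>\<^sub>0 'c) set" where
  "rep_space _ D = {x. Poly_Mapping.keys x \<subseteq> obj D}"

definition rep_basis :: "'c::field itself \<Rightarrow> ('o, 'm, 'k::finite) kgraph_data \<Rightarrow> ('o \<Rightarrow>\<^sub>0 'c) set" where
  "rep_basis _ D = (\<lambda>v. Poly_Mapping.single v 1) ` obj D"

fun letter_act :: "('o, 'm, 'k::finite) kgraph_data \<Rightarrow> ('o, 'm, 'p, 'n) kgraph_map
    \<Rightarrow> 'n letter \<Rightarrow> 'o \<Rightarrow> ('o \<Rightarrow>\<^sub>0 'c::field)" where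
  "letter_act D \<alpha> (Real f) v =
     (if \<exists>d \<in> mor D. src D d = v \<and> mmap \<alpha> d = f
      then Poly_Mapping.single (ran D (THE d. d \<in> mor D \<and> src D d = v \<and> mmap \<alpha> d = f)) 1 else 0)"
| "letter_act D \<alpha> (Ghost f) v =
     (if \<exists>d \<in> mor D. ran D d = v \<and> mmap \<alpha> d = f
      then Poly_Mapping.single (src D (THE d. d \<in> mor D \<and> ran D d = v \<and> mmap \<alpha> d = f)) 1 else 0)"

text \<open>The action of the free algebra on its generators; words act by composition.\<close>

definition free_act :: "('o, 'm, 'k::finite) kgraph_data \<Rightarrow> ('o, 'm, 'p, 'n) kgraph_map
    \<Rightarrow> ('n letter gword \<Rightarrow>\<^sub>0 'c::field) \<Rightarrow> ('o \<Rightarrow>\<^sub>0 'c) \<Rightarrow> ('o \<Rightarrow>\<^sub>0 'c)" where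
  "free_act D \<alpha> f x = lin_ext (\<lambda>w. foldr (\<lambda>g. lin_ext (letter_act D \<alpha> g)) (letters w) x) f"

text \<open>All representatives of a class act in the same way on \<open>rep_space\<close>, so the value below is the
  common one.\<close>

definition rep_act :: "('o, 'm, 'k::finite) kgraph_data \<Rightarrow> ('o, 'm, 'p, 'n) kgraph_map
    \<Rightarrow> ('n letter gword \<Rightarrow>\<^sub>0 'c::field) set \<Rightarrow> ('o \<Rightarrow>\<^sub>0 'c) \<Rightarrow> ('o \<Rightarrow>\<^sub>0 'c)" where
  "rep_act D \<alpha> a x = the_elem ((\<lambda>f. free_act D \<alpha> f x) ` a)"

end

theory Submission
  imports Defs
begin

text \<open>Because \<open>v\<Delta>\<^sup>n\<close> is a singleton and \<open>\<alpha>\<close> is bijective on each \<open>\<Delta>v\<close>, every word in the generators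
  acts on the basis \<open>\<Delta>\<^sup>o\<^sup>b\<close> as a partial injection, and a word is nonzero on \<open>v\<close> exactly when it
  is the image of a walk starting in \<open>v\<close>. If \<open>(\<Delta>, \<alpha>)\<close> is irreducible, two distinct vertices in the
  support of \<open>x\<close> are separated by a walk \<open>p\<close>, so \<open>p.x\<close> is nonzero with strictly smaller support, and
  iterating leads to a multiple of a basis vector. If \<open>u \<noteq> v\<close> carry the same walks, the sum of the
  coefficients of \<open>a.(u - v)\<close> is \<open>0\<close> for every \<open>a\<close>. Simplicity follows from (ii) because
  connectedness of \<open>\<Delta>\<close> lets the algebra move any vertex to any other.\<close>

section \<open>Linear extensions and free algebras\<close>

interpretation pscale: vector_space "pscale :: 'c::field \<Rightarrow> ('a \<Rightarrow>\<^sub>0 'c) \<Rightarrow> 'a \<Rightarrow>\<^sub>0 'c"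
  by (rule vector_space_pscale)

interpretation pscale_pair: vector_space_pair
    "pscale :: 'c::field \<Rightarrow> ('a \<Rightarrow>\<^sub>0 'c) \<Rightarrow> 'a \<Rightarrow>\<^sub>0 'c" "pscale :: 'c \<Rightarrow> ('b \<Rightarrow>\<^sub>0 'c) \<Rightarrow> 'b \<Rightarrow>\<^sub>0 'c"
  by unfold_locales

lemma pscale_single [simp]: "pscale c (Poly_Mapping.single v a) = Poly_Mapping.single v (c * a)"
  by (rule poly_mapping_eqI) (simp add: lookup_single when_def)

lemma single_one_nonzero: "Poly_Mapping.single v (1::'c::field) \<noteq> 0"
  by (metis lookup_single_eq lookup_zero zero_neq_one)

lemma rep_basis_nonzero: "b \<in> rep_basis TYPE('c::field) D \<Longrightarrow> b \<noteq> 0"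
  by (auto simp: rep_basis_def single_one_nonzero)

text \<open>Coefficients outside the support vanish, so any finite superset may index the sum.
  Vectors with different supports can then share one index set.\<close>

lemma lin_ext_superset:
  fixes \<phi> :: "'a \<Rightarrow> ('b \<Rightarrow>\<^sub>0 'c::field)"
  assumes "finite S" "Poly_Mapping.keys x \<subseteq> S"
  shows "lin_ext \<phi> x = (\<Sum>v\<in>S. pscale (Poly_Mapping.lookup x v) (\<phi> v))"
  unfolding lin_ext_def using assms
  by (intro sum.mono_neutral_left) (auto simp: in_keys_iff)

lemma lin_ext_add:
  fixes \<phi> :: "'a \<Rightarrow> ('b \<Rightarrow>\<^sub>0 'c::field)"
  shows "lin_ext \<phi> (x + y) = lin_ext \<phi> x + lin_ext \<phi> y"
proof -
  let ?S = "Poly_Mapping.keys x \<union> Poly_Mapping.keys y"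
  have "Poly_Mapping.keys (x + y) \<subseteq> ?S"
    by (rule Poly_Mapping.keys_add)
  then show ?thesis
    by (simp add: lin_ext_superset[of ?S] lookup_add pscale.scale_left_distrib sum.distrib)
qed

lemma lin_ext_pscale:
  fixes \<phi> :: "'a \<Rightarrow> ('b \<Rightarrow>\<^sub>0 'c::field)"
  shows "lin_ext \<phi> (pscale c x) = pscale c (lin_ext \<phi> x)"
proof -
  have "Poly_Mapping.keys (pscale c x) \<subseteq> Poly_Mapping.keys x"
    by (auto simp: in_keys_iff)
  then show ?thesis
    by (simp add: lin_ext_superset[of "Poly_Mapping.keys x"] pscale.scale_sum_right)
qed

lemma linear_lin_ext:
  "Vector_Spaces.linear pscale pscale (lin_ext \<phi> :: ('a \<Rightarrow>\<^sub>0 'c::field) \<Rightarrow> ('b \<Rightarrow>\<^sub>0 'c))"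
  by unfold_locales (simp_all add: lin_ext_add lin_ext_pscale)

lemma lin_ext_single [simp]:
  fixes \<phi> :: "'a \<Rightarrow> ('b \<Rightarrow>\<^sub>0 'c::field)"
  shows "lin_ext \<phi> (Poly_Mapping.single v a) = pscale a (\<phi> v)"
  by (simp add: lin_ext_superset[of "{v}"])

lemma lookup_lin_ext:
  "Poly_Mapping.lookup (lin_ext \<phi> x) u
     = (\<Sum>v\<in>Poly_Mapping.keys x. Poly_Mapping.lookup x v * Poly_Mapping.lookup (\<phi> v) u)"
  by (simp add: lin_ext_def lookup_sum)

lemma lin_ext_basis [simp]:
  "lin_ext (\<lambda>v. Poly_Mapping.single v 1) x = (x :: 'a \<Rightarrow>\<^sub>0 'c::field)"
  by (rule poly_mapping_eqI)
    (simp add: lookup_lin_ext lookup_single when_def in_keys_iff if_distrib cong: if_cong)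

text \<open>Every vector is a finite sum of multiples of basis vectors. Zero needs no case of its
  own: it is \<open>single\<close> with coefficient 0 at an arbitrary index.\<close>

lemma poly_mapping_add_induct [case_names single add]:
  fixes x :: "'a \<Rightarrow>\<^sub>0 'c::field"
  assumes single: "\<And>v a. P (Poly_Mapping.single v a)"
    and add: "\<And>x y. P x \<Longrightarrow> P y \<Longrightarrow> P (x + y)"
  shows "P x"
proof -
  have "P (\<Sum>v\<in>S. Poly_Mapping.single v (Poly_Mapping.lookup x v))" if "finite S" for S
    using that
  proof (induction S rule: finite_induct)
    case empty
    show ?case using single[of undefined 0] by simp
  qed (simp add: assms)
  from this[of "Poly_Mapping.keys x"] show ?thesis
    using lin_ext_basis[of x, unfolded lin_ext_def] by simp
qed

lemma free_alg_closed:
  fixes f g :: "'g gword \<Rightarrow>\<^sub>0 'c::field"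
  assumes "f \<in> free_alg X" "g \<in> free_alg X"
  shows free_alg_add: "f + g \<in> free_alg X"
    and free_alg_mult: "f * g \<in> free_alg X"
proof -
  show "f + g \<in> free_alg X"
    using assms Poly_Mapping.keys_add[of f g] unfolding free_alg_def by blast
  show "f * g \<in> free_alg X"
    using assms keys_mult[of f g] unfolding free_alg_def by (fastforce simp: plus_gword_def)
qed

lemma free_alg_pscale:
  fixes f :: "'g gword \<Rightarrow>\<^sub>0 'c::field"
  shows "f \<in> free_alg X \<Longrightarrow> pscale c f \<in> free_alg X"
  by (auto simp: free_alg_def in_keys_iff)

lemma zero_in_free_alg: "(0 :: 'g gword \<Rightarrow>\<^sub>0 'c::field) \<in> free_alg X"
  by (simp add: free_alg_def)

lemma monomial_in_free_alg:
  "ws \<noteq> [] \<Longrightarrow> set ws \<subseteq> X \<Longrightarrow> (monomial ws :: 'g gword \<Rightarrow>\<^sub>0 'c::field) \<in> free_alg X"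
  by (simp add: free_alg_def monomial_def)

section \<open>Presented algebras\<close>

abbreviation cls ::
    "'g set \<Rightarrow> ('g gword \<Rightarrow>\<^sub>0 'c::field) set \<Rightarrow> ('g gword \<Rightarrow>\<^sub>0 'c) \<Rightarrow> ('g gword \<Rightarrow>\<^sub>0 'c) set" where
  "cls X R f \<equiv> ideal_cong X R `` {f}"

lemma gen_ideal_minus_commute:
  fixes f g :: "'g gword \<Rightarrow>\<^sub>0 'c::field"
  assumes "f - g \<in> gen_ideal X R"
  shows "g - f \<in> gen_ideal X R"
  \<comment> \<open>\<open>gen_ideal\<close> has no closure rule for negatives; scaling by -1
    provides it.\<close>
  using gen_ideal.scale[OF assms, of "- 1"] by (simp add: pscale.scale_minus_left)

lemma equiv_ideal_cong: "equiv (free_alg X) (ideal_cong X R)"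
proof (rule equivI)
  show "ideal_cong X R \<subseteq> free_alg X \<times> free_alg X" "refl_on (free_alg X) (ideal_cong X R)"
    by (auto simp: ideal_cong_def refl_on_def gen_ideal.zero)
  show "sym (ideal_cong X R)"
    by (auto simp: ideal_cong_def intro!: symI gen_ideal_minus_commute)
  show "trans (ideal_cong X R)"
    by (rule transI) (auto simp: ideal_cong_def dest: gen_ideal.add)
qed

text \<open>Well-definedness of the operations, which are unions over all representatives: if
  \<open>F\<close> respects the congruence, every class in the union is the same one.\<close>

lemma cls_Union:
  fixes F :: "('g gword \<Rightarrow>\<^sub>0 'c::field) \<Rightarrow> ('g gword \<Rightarrow>\<^sub>0 'c)"
  assumes "f \<in> free_alg X"
    and "\<And>g. (f, g) \<in> ideal_cong X R \<Longrightarrow> (F f, F g) \<in> ideal_cong X R"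
  shows "(\<Union>g \<in> cls X R f. cls X R (F g)) = cls X R (F f)"
proof -
  have "cls X R (F g) = cls X R (F f)" if "g \<in> cls X R f" for g
    using that assms(2) equiv_class_eq[OF equiv_ideal_cong] by blast
  moreover have "f \<in> cls X R f"
    using assms(1) equiv_class_self[OF equiv_ideal_cong] by blast
  ultimately show ?thesis by blast
qed

lemma carr_presented_alg: "carr (presented_alg X R) = cls X R ` free_alg X"
  by (auto simp: presented_alg_def quotient_def)

lemma presented_alg_ops:
  fixes f g :: "'g gword \<Rightarrow>\<^sub>0 'c::field"
  assumes f: "f \<in> free_alg X"
  shows ascale_cls: "ascale (presented_alg X R) c (cls X R f) = cls X R (pscale c f)"
    and aadd_cls: "g \<in> free_alg X \<Longrightarrow>
      aadd (presented_alg X R) (cls X R f) (cls X R g) = cls X R (f + g)"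
    and amult_cls: "g \<in> free_alg X \<Longrightarrow>
      amult (presented_alg X R) (cls X R f) (cls X R g) = cls X R (f * g)"
proof -
  show "ascale (presented_alg X R) c (cls X R f) = cls X R (pscale c f)"
    unfolding presented_alg_def using f
    by (simp, intro cls_Union)
      (auto simp: ideal_cong_def free_alg_pscale gen_ideal.scale simp flip: pscale.scale_right_diff_distrib)
next
  assume g: "g \<in> free_alg X"
  \<comment> \<open>The inner union collapses first, with an element \<open>f'\<close> held fixed on
    the left; the outer union then depends on \<open>f'\<close> alone.\<close>
  have "(\<Union>g' \<in> cls X R g. cls X R (f' + g')) = cls X R (f' + g)" if "f' \<in> free_alg X" for f'
    using that by (intro cls_Union g) (auto simp: ideal_cong_def free_alg_add)
  moreover have "(\<Union>f' \<in> cls X R f. cls X R (f' + g)) = cls X R (f + g)"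
    by (intro cls_Union f) (auto simp: ideal_cong_def free_alg_add g)
  ultimately show "aadd (presented_alg X R) (cls X R f) (cls X R g) = cls X R (f + g)"
    by (simp add: presented_alg_def ideal_cong_def)
next
  assume g: "g \<in> free_alg X"
  have "(\<Union>g' \<in> cls X R g. cls X R (f' * g')) = cls X R (f' * g)" if "f' \<in> free_alg X" for f'
    using that by (intro cls_Union g)
      (auto simp: ideal_cong_def free_alg_mult gen_ideal.mult_left simp flip: right_diff_distrib)
  moreover have "(\<Union>f' \<in> cls X R f. cls X R (f' * g)) = cls X R (f * g)"
    by (intro cls_Union f)
      (auto simp: ideal_cong_def free_alg_mult gen_ideal.mult_right g simp flip: left_diff_distrib)
  ultimately show "amult (presented_alg X R) (cls X R f) (cls X R g) = cls X R (f * g)"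
    by (simp add: presented_alg_def ideal_cong_def)
qed

section \<open>Edges lifted along a representation\<close>

context kgraph
begin

text \<open>For 0 = 0 + 0, both identity laws factor \<open>f\<close> into parts of degree 0.
  Uniqueness of the factorization makes them the same pair, so \<open>f\<close> is an
  identity.\<close>

lemma deg_eq_0_iff:
  assumes "f \<in> mor L"
  shows "deg L f = 0 \<longleftrightarrow> f \<in> idm L ` obj L"
proof
  assume 0: "deg L f = 0"
  then have "\<exists>!(g, h). g \<in> mor L \<and> h \<in> mor L \<and> deg L g = 0 \<and> deg L h = 0
      \<and> src L g = ran L h \<and> f = cmp L g h"
    using factorization[OF assms, of 0 0] by simp
  moreover have "f = cmp L (idm L (ran L f)) f" "f = cmp L f (idm L (src L f))"
    using assms by (simp_all add: cmp_idm_left cmp_idm_right)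
  ultimately have "(idm L (ran L f), f) = (f, idm L (src L f))"
    using assms 0 by (smt (verit) Ex1_def case_prod_conv deg_idm idm_mor ran_idm ran_obj src_idm src_obj)
  then show "f \<in> idm L ` obj L"
    using ran_obj[OF assms] by (metis Pair_inject image_eqI)
qed (auto simp: deg_idm)

lemma factorization_unique:
  assumes "g \<in> mor L" "h \<in> mor L" "src L g = ran L h"
    and "g' \<in> mor L" "h' \<in> mor L" "src L g' = ran L h'"
    and "deg L g = deg L g'" "deg L h = deg L h'" "cmp L g h = cmp L g' h'"
  shows "g = g'" "h = h'"
proof -
  have "\<exists>!(a, b). a \<in> mor L \<and> b \<in> mor L \<and> deg L a = deg L g \<and> deg L b = deg L h
      \<and> src L a = ran L b \<and> cmp L g h = cmp L a b"
    using assms by (intro factorization) (simp_all add: cmp_mor deg_cmp)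
  then have "(g, h) = (g', h')"
    using assms by (smt (verit) Ex1_def case_prod_conv)
  then show "g = g'" "h = h'" by simp_all
qed

text \<open>Generators single out morphisms of degree 0, edges single out identities, and these are
  the same morphisms. Words in the generators are thus words in the edges.\<close>

lemma kp_gens_eq_walk_edges: "kp_gens L = walk_edges L"
  using deg_eq_0_iff unfolding kp_gens_def walk_edges_def star_def by auto

end

section \<open>Letters and words as relations on vertices\<close>

fun moves :: "('o, 'm, 'k::finite) kgraph_data \<Rightarrow> ('o, 'm, 'p, 'n) kgraph_map
    \<Rightarrow> 'n letter \<Rightarrow> 'o \<Rightarrow> 'o \<Rightarrow> bool" where
  "moves D \<alpha> (Real f) v u \<longleftrightarrow> (\<exists>d \<in> mor D. src D d = v \<and> ran D d = u \<and> mmap \<alpha> d = f)"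
| "moves D \<alpha> (Ghost f) v u \<longleftrightarrow> (\<exists>d \<in> mor D. ran D d = v \<and> src D d = u \<and> mmap \<alpha> d = f)"

text \<open>Words are read from the right, as in \<open>foldr\<close> and in composition of
  morphisms. The empty word is the identity relation on the whole type, not only on the
  vertices.\<close>

fun word_moves :: "('o, 'm, 'k::finite) kgraph_data \<Rightarrow> ('o, 'm, 'p, 'n) kgraph_map
    \<Rightarrow> 'n letter list \<Rightarrow> 'o \<Rightarrow> 'o \<Rightarrow> bool" where
  "word_moves D \<alpha> [] v u \<longleftrightarrow> v = u"
| "word_moves D \<alpha> (g # ws) v u \<longleftrightarrow> (\<exists>t. word_moves D \<alpha> ws v t \<and> moves D \<alpha> g t u)"

abbreviation word_act :: "('o, 'm, 'k::finite) kgraph_data \<Rightarrow> ('o, 'm, 'p, 'n) kgraph_map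
    \<Rightarrow> 'n letter list \<Rightarrow> ('o \<Rightarrow>\<^sub>0 'c::field) \<Rightarrow> ('o \<Rightarrow>\<^sub>0 'c)" where
  "word_act D \<alpha> ws \<equiv> foldr (\<lambda>g. lin_ext (letter_act D \<alpha> g)) ws"

text \<open>\<open>representation_kgraph\<close> carries the standing assumptions for \<Delta> only;
  here \<Lambda> gets them too, so that the sums in (KP4) are finite.\<close>

locale std_representation = representation_kgraph D L \<alpha> + cod: std_kgraph L
  for D :: "('o, 'm, 'k::finite) kgraph_data" and L :: "('p, 'n, 'k) kgraph_data"
    and \<alpha> :: "('o, 'm, 'p, 'n) kgraph_map"
begin

lemma lift_unique_src:
  assumes "d \<in> mor D" "d' \<in> mor D" "src D d = src D d'" "mmap \<alpha> d = mmap \<alpha> d'"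
  shows "d = d'"
  using bij_betw_imp_inj_on[OF bij_out[OF dom.src_obj[OF assms(1)]]] assms
  by (auto simp: inj_on_def out_of_def)

lemma lift_exists:
  assumes "v \<in> obj D" "f \<in> mor L" "src L f = omap \<alpha> v"
  obtains d where "d \<in> mor D" "src D d = v" "mmap \<alpha> d = f"
proof -
  have "f \<in> mmap \<alpha> ` out_of D v"
    using bij_out[OF assms(1)] assms by (auto simp: bij_betw_def out_of_def)
  then show thesis using that by (auto simp: out_of_def)
qed

text \<open>Each vertex of \<Delta> receives exactly one morphism of each degree, so range and
  degree alone determine a morphism.\<close>

lemma lift_unique_ran:
  assumes "d \<in> mor D" "d' \<in> mor D" "ran D d = ran D d'" "deg D d = deg D d'"
  shows "d = d'"
proof -
  have "d \<in> into_deg D (ran D d) (deg D d)" "d' \<in> into_deg D (ran D d) (deg D d)"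
    using assms by (simp_all add: into_deg_def)
  then show ?thesis
    using singleton_into[OF dom.ran_obj[OF assms(1)]] by (metis is_singletonE singletonD)
qed

lemma lift_unique_ran_map:
  assumes "d \<in> mor D" "d' \<in> mor D" "ran D d = ran D d'" "mmap \<alpha> d = mmap \<alpha> d'"
  shows "d = d'"
  using assms by (metis lift_unique_ran mmap_deg)

lemma moves_obj: "moves D \<alpha> g v u \<Longrightarrow> v \<in> obj D \<and> u \<in> obj D"
  by (cases g) (auto simp: dom.src_obj dom.ran_obj)

text \<open>For real letters this is injectivity of \<alpha> on morphisms with a common source, for
  ghost letters uniqueness of the morphism of given degree into a vertex.\<close>

lemma moves_det: "moves D \<alpha> g v u \<Longrightarrow> moves D \<alpha> g v u' \<Longrightarrow> u = u'"
  by (cases g) (auto dest: lift_unique_src lift_unique_ran_map)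

text \<open>Same two facts as for \<open>moves_det\<close>, with real and ghost letters
  exchanged.\<close>

lemma moves_inj: "moves D \<alpha> g v u \<Longrightarrow> moves D \<alpha> g v' u \<Longrightarrow> v = v'"
  by (cases g) (auto dest: lift_unique_src lift_unique_ran_map)

lemma word_moves_det: "word_moves D \<alpha> ws v u \<Longrightarrow> word_moves D \<alpha> ws v u' \<Longrightarrow> u = u'"
  by (induction ws arbitrary: u u') (auto, metis moves_det)

lemma word_moves_inj: "word_moves D \<alpha> ws v u \<Longrightarrow> word_moves D \<alpha> ws v' u \<Longrightarrow> v = v'"
  by (induction ws arbitrary: u) (auto, metis moves_inj)

text \<open>Replaces the choice of a lift by the choice of its endpoint, which treats real and ghost
  letters uniformly.\<close>

lemma letter_act_eq:
  "letter_act D \<alpha> g v = (if \<exists>u. moves D \<alpha> g v u then Poly_Mapping.single (THE u. moves D \<alpha> g v u) 1 else 0)"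
proof (cases "\<exists>u. moves D \<alpha> g v u")
  case True
  then obtain u where u: "moves D \<alpha> g v u" ..
  have the: "(THE u. moves D \<alpha> g v u) = u"
    using u moves_det by blast
  show ?thesis
  proof (cases g)
    case (Real f)
    then obtain d where d: "d \<in> mor D" "src D d = v" "ran D d = u" "mmap \<alpha> d = f"
      using u by auto
    then have "(THE d. d \<in> mor D \<and> src D d = v \<and> mmap \<alpha> d = f) = d"
      by (intro the_equality) (auto intro: lift_unique_src)
    then show ?thesis unfolding the using d u Real by auto
  next
    case (Ghost f)
    then obtain d where d: "d \<in> mor D" "ran D d = v" "src D d = u" "mmap \<alpha> d = f"
      using u by auto
    then have "(THE d. d \<in> mor D \<and> ran D d = v \<and> mmap \<alpha> d = f) = d"
      by (intro the_equality) (auto intro: lift_unique_ran_map)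
    then show ?thesis unfolding the using d u Ghost by auto
  qed
next
  case False
  then show ?thesis by (cases g) auto
qed

lemma lookup_letter_act:
  "Poly_Mapping.lookup (letter_act D \<alpha> g v) u = (if moves D \<alpha> g v u then 1 else 0)"
proof (cases "\<exists>t. moves D \<alpha> g v t")
  case True
  then obtain t where t: "moves D \<alpha> g v t" ..
  then have "(THE u. moves D \<alpha> g v u) = t" using moves_det by blast
  then show ?thesis using t by (auto simp: letter_act_eq lookup_single when_def dest: moves_det)
qed (auto simp: letter_act_eq)

text \<open>By \<open>moves_inj\<close> at most one basis vector contributes to the coefficient at
  \<open>u\<close>.\<close>

lemma lookup_letter_ext:
  "moves D \<alpha> g v u \<Longrightarrow>
     Poly_Mapping.lookup (lin_ext (letter_act D \<alpha> g) x) u = Poly_Mapping.lookup x v"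
  "\<nexists>v. moves D \<alpha> g v u \<Longrightarrow> Poly_Mapping.lookup (lin_ext (letter_act D \<alpha> g) x) u = 0"
proof -
  assume v: "moves D \<alpha> g v u"
  have "Poly_Mapping.lookup (lin_ext (letter_act D \<alpha> g) x) u
      = (\<Sum>t\<in>Poly_Mapping.keys x. if t = v then Poly_Mapping.lookup x t else 0)"
    unfolding lookup_lin_ext lookup_letter_act using v
    by (intro sum.cong) (auto dest: moves_inj)
  then show "Poly_Mapping.lookup (lin_ext (letter_act D \<alpha> g) x) u = Poly_Mapping.lookup x v"
    by (simp add: in_keys_iff)
qed (simp add: lookup_lin_ext lookup_letter_act)

text \<open>Words act as partial injections of the basis, so on coefficients they act by pullback.\<close>

lemma lookup_word_act:
  "word_moves D \<alpha> ws v u \<Longrightarrow>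
     Poly_Mapping.lookup (word_act D \<alpha> ws x) u = Poly_Mapping.lookup x v"
  "\<nexists>v. word_moves D \<alpha> ws v u \<Longrightarrow> Poly_Mapping.lookup (word_act D \<alpha> ws x) u = 0"
proof (induction ws arbitrary: u)
  case (Cons g ws)
  {
    case 1
    then show ?case using Cons.IH(1) by (auto simp: lookup_letter_ext)
  next
    case 2
    show ?case
    proof (cases "\<exists>t. moves D \<alpha> g t u")
      case True
      then obtain t where t: "moves D \<alpha> g t u" ..
      then have "\<nexists>v. word_moves D \<alpha> ws v t" using 2 by auto
      then show ?thesis using Cons.IH(2) t by (simp add: lookup_letter_ext)
    qed (simp add: lookup_letter_ext)
  }
qed auto

lemma word_act_linear: "Vector_Spaces.linear pscale pscale (word_act D \<alpha> ws :: ('o \<Rightarrow>\<^sub>0 'c::field) \<Rightarrow> _)"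
proof (induction ws)
  case Nil
  show ?case by unfold_locales simp_all
next
  case (Cons g ws)
  show ?case
    using Vector_Spaces.linear_compose[OF Cons linear_lin_ext[of "letter_act D \<alpha> g"]]
    by (simp add: comp_def)
qed

lemma word_act_single:
  "word_act D \<alpha> ws (Poly_Mapping.single v 1) =
     (if \<exists>u. word_moves D \<alpha> ws v u then Poly_Mapping.single (THE u. word_moves D \<alpha> ws v u) 1 else 0)"
    (is "?l = ?r")
proof (rule poly_mapping_eqI)
  fix u
  have the: "(THE u. word_moves D \<alpha> ws v u) = t" if "word_moves D \<alpha> ws v t" for t
    using that word_moves_det by blast
  show "Poly_Mapping.lookup ?l u = Poly_Mapping.lookup ?r u"
  proof (cases "\<exists>t. word_moves D \<alpha> ws t u")
    case True
    then obtain t where "word_moves D \<alpha> ws t u" ..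
    then show ?thesis
      using the by (auto simp: lookup_word_act lookup_single when_def dest: word_moves_inj)
  next
    case False
    then show ?thesis
      using the by (auto simp: lookup_word_act(2) lookup_single when_def)
  qed
qed

lemma word_act_single_moves:
  assumes "word_moves D \<alpha> ws v u"
  shows "word_act D \<alpha> ws (Poly_Mapping.single v 1) = Poly_Mapping.single u 1"
proof -
  have "(THE u. word_moves D \<alpha> ws v u) = u"
    using assms word_moves_det by blast
  then show ?thesis using assms unfolding word_act_single by auto
qed

text \<open>Reduces an identity between two words on the module to equality of two relations on
  vertices, the form in which the Kumjian-Pask relations are checked.\<close>

lemma word_act_cong:
  assumes "\<And>v u. word_moves D \<alpha> ws v u \<longleftrightarrow> word_moves D \<alpha> ws' v u"
  shows "word_act D \<alpha> ws x = word_act D \<alpha> ws' x"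
proof (rule poly_mapping_eqI)
  fix u
  show "Poly_Mapping.lookup (word_act D \<alpha> ws x) u = Poly_Mapping.lookup (word_act D \<alpha> ws' x) u"
  proof (cases "\<exists>v. word_moves D \<alpha> ws v u")
    case True
    then show ?thesis using assms by (metis lookup_word_act(1))
  next
    case False
    then show ?thesis using assms by (simp add: lookup_word_act(2))
  qed
qed

lemma word_act_eq_0:
  assumes "\<And>v u. \<not> word_moves D \<alpha> ws v u"
  shows "word_act D \<alpha> ws x = 0"
  by (rule poly_mapping_eqI) (simp add: assms lookup_word_act(2))

section \<open>The Kumjian-Pask relations hold on the module\<close>

lemma lift_idm:
  assumes "d \<in> mor D" "deg D d = 0"
  obtains "d = idm D (src D d)" "ran D d = src D d"
  using assms dom.deg_eq_0_iff[OF assms(1)] by (auto simp: dom.src_idm dom.ran_idm)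

text \<open>A lift of an identity has degree 0 and is itself an identity. Hence the letter acts as
  the projection onto the vertices lying over \<open>w\<close>.\<close>

lemma moves_idm:
  assumes "w \<in> obj L"
  shows "moves D \<alpha> (Real (idm L w)) v u \<longleftrightarrow> v = u \<and> v \<in> obj D \<and> omap \<alpha> v = w"
proof
  assume "moves D \<alpha> (Real (idm L w)) v u"
  then obtain d where d: "d \<in> mor D" "src D d = v" "ran D d = u" "mmap \<alpha> d = idm L w" by auto
  then have "deg D d = 0" using assms cod.deg_idm mmap_deg by metis
  then show "v = u \<and> v \<in> obj D \<and> omap \<alpha> v = w"
    using d assms by (metis lift_idm cod.src_idm dom.src_obj mmap_src)
next
  assume "v = u \<and> v \<in> obj D \<and> omap \<alpha> v = w"
  then show "moves D \<alpha> (Real (idm L w)) v u"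
    by (auto intro!: bexI[of _ "idm D v"] simp: dom.idm_mor dom.src_idm dom.ran_idm mmap_idm)
qed

text \<open>\<open>star\<close> and \<open>Ghost\<close> differ only in degree 0, where every lift
  is an identity and both directions of travel agree.\<close>

lemma moves_star:
  assumes "f \<in> mor L"
  shows "moves D \<alpha> (star L f) v u \<longleftrightarrow> moves D \<alpha> (Ghost f) v u"
proof (cases "deg L f = 0")
  case True
  have "ran D d = src D d" if "d \<in> mor D" "mmap \<alpha> d = f" for d
    using that True by (metis lift_idm mmap_deg)
  then show ?thesis using True unfolding star_def by (simp, metis)
qed (simp add: star_def)

text \<open>A lift of the composite factors in \<Delta> with the degrees of \<open>f\<close> and
  \<open>g\<close>; unique factorization in \<Lambda> then identifies the images of the two factors
  with \<open>f\<close> and \<open>g\<close>.\<close>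

lemma moves_cmp:
  assumes "f \<in> mor L" "g \<in> mor L" "src L f = ran L g"
  shows "moves D \<alpha> (Real (cmp L f g)) v u
     \<longleftrightarrow> (\<exists>t. moves D \<alpha> (Real g) v t \<and> moves D \<alpha> (Real f) t u)"
proof
  assume "moves D \<alpha> (Real (cmp L f g)) v u"
  then obtain d where d: "d \<in> mor D" "src D d = v" "ran D d = u" "mmap \<alpha> d = cmp L f g" by auto
  then have "deg D d = deg L f + deg L g"
    using assms cod.deg_cmp mmap_deg by metis
  then obtain a b where ab: "a \<in> mor D" "b \<in> mor D" "deg D a = deg L f" "deg D b = deg L g"
      "src D a = ran D b" "d = cmp D a b"
    using dom.factorization[OF d(1), of "deg L f" "deg L g"] by blast
  have "mmap \<alpha> a = f" "mmap \<alpha> b = g"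
    using cod.factorization_unique[of "mmap \<alpha> a" "mmap \<alpha> b" f g] assms ab d
    by (auto simp: mmap_mor mmap_src mmap_ran mmap_deg mmap_cmp)
  then show "\<exists>t. moves D \<alpha> (Real g) v t \<and> moves D \<alpha> (Real f) t u"
    using ab d by (auto simp: dom.src_cmp dom.ran_cmp)
next
  assume "\<exists>t. moves D \<alpha> (Real g) v t \<and> moves D \<alpha> (Real f) t u"
  then obtain a b where "a \<in> mor D" "b \<in> mor D" "src D b = v" "ran D b = src D a" "ran D a = u"
      "mmap \<alpha> a = f" "mmap \<alpha> b = g"
    by auto
  then show "moves D \<alpha> (Real (cmp L f g)) v u"
    by (auto intro!: bexI[of _ "cmp D a b"] simp: dom.src_cmp dom.ran_cmp mmap_cmp dom.cmp_mor)
qed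

lemma moves_Ghost_iff: "moves D \<alpha> (Ghost f) v u \<longleftrightarrow> moves D \<alpha> (Real f) u v"
  by auto

lemma moves_Real_omap:
  assumes "moves D \<alpha> (Real f) v u"
  shows "src L f = omap \<alpha> v" "ran L f = omap \<alpha> u" "f \<in> mor L"
  using assms by (auto simp: mmap_src mmap_ran mmap_mor)

text \<open>(KP1). A move along \<open>g\<close> ends over \<open>ran L g\<close> and one along
  \<open>f\<close> starts over \<open>src L f\<close>, so the word relates no vertices unless these
  agree.\<close>

lemma word_act_real_real:
  assumes "f \<in> mor L" "g \<in> mor L"
  shows "word_act D \<alpha> [Real f, Real g] x
    = (if src L f = ran L g then word_act D \<alpha> [Real (cmp L f g)] x else 0)"
proof (cases "src L f = ran L g")
  case True
  then have "word_act D \<alpha> [Real f, Real g] x = word_act D \<alpha> [Real (cmp L f g)] x"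
    by (intro word_act_cong) (auto simp: moves_cmp[OF assms True] simp del: moves.simps)
  then show ?thesis using True by simp
next
  case False
  have "\<not> word_moves D \<alpha> [Real f, Real g] v u" for v u
    using False moves_Real_omap by (simp only: word_moves.simps) metis
  then show ?thesis using False word_act_eq_0 by metis
qed

text \<open>(KP2). A ghost letter is the converse relation of the real one, so this is (KP1) read
  backwards.\<close>

lemma word_act_star_star:
  assumes "f \<in> mor L" "g \<in> mor L"
  shows "word_act D \<alpha> [star L g, star L f] x
    = (if src L f = ran L g then word_act D \<alpha> [star L (cmp L f g)] x else 0)"
proof (cases "src L f = ran L g")
  case True
  then have "cmp L f g \<in> mor L" using assms by (simp add: cod.cmp_mor)
  then have "word_act D \<alpha> [star L g, star L f] x = word_act D \<alpha> [star L (cmp L f g)] x"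
    by (intro word_act_cong) (auto simp: moves_star assms moves_Ghost_iff
        moves_cmp[OF assms True] simp del: moves.simps)
  then show ?thesis using True by simp
next
  case False
  have "\<not> word_moves D \<alpha> [star L g, star L f] v u" for v u
    using False moves_Real_omap
    by (simp only: word_moves.simps moves_star assms moves_Ghost_iff) metis
  then show ?thesis using False word_act_eq_0 by metis
qed

text \<open>(KP3). If \<open>f = g\<close>, going forth and back returns to the start by
  injectivity, and every vertex over \<open>src L f\<close> has a lift of \<open>f\<close>. If not,
  lifts with a common range and equal degree would coincide.\<close>

lemma word_act_star_real:
  assumes "f \<in> mor L" "g \<in> mor L" "deg L f = deg L g"
  shows "word_act D \<alpha> [star L f, Real g] x
    = (if f = g then word_act D \<alpha> [Real (idm L (src L f))] x else 0)"
proof (cases "f = g")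
  case True
  have "word_moves D \<alpha> [star L f, Real g] v u \<longleftrightarrow> word_moves D \<alpha> [Real (idm L (src L f))] v u" for v u
  proof
    assume "word_moves D \<alpha> [star L f, Real g] v u"
    then obtain t where t: "moves D \<alpha> (Real f) v t" "moves D \<alpha> (Real f) u t"
      using True by (auto simp: moves_star assms simp del: moves.simps) (auto simp: moves_Ghost_iff)
    then have "v = u" by (rule moves_inj)
    then show "word_moves D \<alpha> [Real (idm L (src L f))] v u"
      using moves_obj[OF t(1)] moves_Real_omap(1)[OF t(1)]
      by (simp add: moves_idm omap_obj del: moves.simps)
  next
    assume "word_moves D \<alpha> [Real (idm L (src L f))] v u"
    then have "v = u" "v \<in> obj D" "src L f = omap \<alpha> v"
      by (auto simp: moves_idm cod.src_obj assms simp del: moves.simps)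
    then obtain t where "moves D \<alpha> (Real f) v t" using lift_exists assms(1) by (metis moves.simps(1))
    then show "word_moves D \<alpha> [star L f, Real g] v u"
      using \<open>v = u\<close> True by (auto simp: moves_star assms moves_Ghost_iff simp del: moves.simps)
  qed
  then show ?thesis using True word_act_cong by metis
next
  case False
  have "\<not> word_moves D \<alpha> [star L f, Real g] v u" for v u
  proof
    assume "word_moves D \<alpha> [star L f, Real g] v u"
    then obtain d e where "d \<in> mor D" "e \<in> mor D" "mmap \<alpha> d = f" "mmap \<alpha> e = g" "ran D d = ran D e"
      by (auto simp: moves_star assms simp del: moves.simps) auto
    then show False
      using False assms(3) lift_unique_ran mmap_deg by metis
  qed
  then show ?thesis using False word_act_eq_0 by metis
qed

text \<open>(KP4). A vertex \<open>u\<close> over \<open>w\<close> receives exactly one morphism of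
  degree \<open>n\<close>, so only the summand of its image contributes at \<open>u\<close>; at all
  other vertices both sides vanish.\<close>

lemma word_act_real_star_sum:
  assumes w: "w \<in> obj L"
  shows "(\<Sum>f \<in> into_deg L w n. word_act D \<alpha> [Real f, star L f] x) = word_act D \<alpha> [Real (idm L w)] x"
proof (rule poly_mapping_eqI)
  fix u
  have fin: "finite (into_deg L w n)" using w by (rule cod.row_finite)
  \<comment> \<open>The word goes back along a lift of \<open>f\<close> and forth along one with the
    same source, hence the same lift: it is the projection onto vertices that receive a lift of
    \<open>f\<close>.\<close>
  have moves_iff: "word_moves D \<alpha> [Real f, star L f] v u \<longleftrightarrow> v = u \<and> (\<exists>d \<in> mor D. ran D d = u \<and> mmap \<alpha> d = f)"
    if "f \<in> into_deg L w n" for f v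
  proof -
    have "f \<in> mor L" using that by (simp add: into_deg_def)
    then show ?thesis
      by (auto simp: moves_star simp del: moves.simps) (auto dest: lift_unique_src)
  qed
  show "Poly_Mapping.lookup (\<Sum>f \<in> into_deg L w n. word_act D \<alpha> [Real f, star L f] x) u
      = Poly_Mapping.lookup (word_act D \<alpha> [Real (idm L w)] x) u"
  proof (cases "u \<in> obj D \<and> omap \<alpha> u = w")
    case True
    then obtain d where "into_deg D u n = {d}"
      using singleton_into is_singletonE by metis
    then have d: "d \<in> mor D" "ran D d = u" "deg D d = n"
      and uniq: "\<And>e. e \<in> mor D \<Longrightarrow> ran D e = u \<Longrightarrow> deg D e = n \<Longrightarrow> e = d"
      unfolding into_deg_def by blast+
    have mem: "mmap \<alpha> d \<in> into_deg L w n"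
      using d True by (simp add: into_deg_def mmap_mor mmap_ran mmap_deg)
    have "Poly_Mapping.lookup (word_act D \<alpha> [Real f, star L f] x) u
        = (if f = mmap \<alpha> d then Poly_Mapping.lookup x u else 0)"
      if f: "f \<in> into_deg L w n" for f
    proof (cases "f = mmap \<alpha> d")
      case True
      then have "word_moves D \<alpha> [Real f, star L f] u u" using moves_iff[OF f] d by blast
      then show ?thesis using True lookup_word_act(1) by metis
    next
      case False
      have "\<not> word_moves D \<alpha> [Real f, star L f] v u" for v
        using f uniq False unfolding moves_iff[OF f] into_deg_def by (auto simp: mmap_deg)
      then show ?thesis using False lookup_word_act(2) by (metis (full_types))
    qed
    then have "Poly_Mapping.lookup (\<Sum>f \<in> into_deg L w n. word_act D \<alpha> [Real f, star L f] x) u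
        = Poly_Mapping.lookup x u"
      using fin mem by (simp add: lookup_sum del: foldr.simps)
    moreover have "word_moves D \<alpha> [Real (idm L w)] u u"
      using True w by (simp add: moves_idm del: moves.simps)
    ultimately show ?thesis using lookup_word_act(1) by metis
  next
    case False
    have "\<not> word_moves D \<alpha> [Real f, star L f] v u" if f: "f \<in> into_deg L w n" for f v
      using f False unfolding moves_iff[OF f] into_deg_def by (auto simp: mmap_ran dom.ran_obj)
    then have "Poly_Mapping.lookup (word_act D \<alpha> [Real f, star L f] x) u = 0"
      if "f \<in> into_deg L w n" for f
      using that by (intro lookup_word_act(2)) blast
    moreover have "\<not> word_moves D \<alpha> [Real (idm L w)] v u" for v
      using False w by (auto simp: moves_idm simp del: moves.simps)
    then have "Poly_Mapping.lookup (word_act D \<alpha> [Real (idm L w)] x) u = 0"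
      by (intro lookup_word_act(2)) blast
    ultimately show ?thesis by (simp add: lookup_sum del: foldr.simps)
  qed
qed

section \<open>The action\<close>

lemma free_act_linear_left:
  "Vector_Spaces.linear pscale pscale (\<lambda>f. free_act D \<alpha> f (x :: 'o \<Rightarrow>\<^sub>0 'c::field))"
  unfolding free_act_def by (rule linear_lin_ext)

lemma free_act_linear_right:
  "Vector_Spaces.linear pscale pscale (free_act D \<alpha> f :: ('o \<Rightarrow>\<^sub>0 'c::field) \<Rightarrow> _)"
  \<comment> \<open>Instantiating with \<open>f\<close> unfolds only the outer extension, over the
    words of \<open>f\<close>; each single word stays a linear map.\<close>
  unfolding free_act_def lin_ext_def[of _ f]
  by (intro pscale_pair.linear_compose_sum pscale_pair.linear_compose_scale_right ballI word_act_linear)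

lemma free_act_add_left: "free_act D \<alpha> (f + g) x = free_act D \<alpha> f x + free_act D \<alpha> g x"
  unfolding free_act_def by (rule lin_ext_add)

lemma free_act_pscale_left: "free_act D \<alpha> (pscale c f) x = pscale c (free_act D \<alpha> f x)"
  unfolding free_act_def by (rule lin_ext_pscale)

lemmas free_act_diff_left = pscale_pair.linear_diff[OF free_act_linear_left]
lemmas free_act_sum_left = pscale_pair.linear_sum[OF free_act_linear_left]
lemmas free_act_zero_left = pscale_pair.linear_0[OF free_act_linear_left]
lemmas free_act_add_right = pscale_pair.linear_add[OF free_act_linear_right]
lemmas free_act_diff_right = pscale_pair.linear_diff[OF free_act_linear_right]
lemmas free_act_pscale_right = pscale_pair.linear_scale[OF free_act_linear_right]
lemmas free_act_zero_right = pscale_pair.linear_0[OF free_act_linear_right]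

lemma free_act_single:
  "free_act D \<alpha> (Poly_Mapping.single w c) x = pscale c (word_act D \<alpha> (letters w) x)"
  by (simp add: free_act_def)

lemma free_act_monomial: "free_act D \<alpha> (monomial ws) x = word_act D \<alpha> ws x"
  by (simp add: monomial_def free_act_single)

text \<open>Both sides are additive in \<open>f\<close> and in \<open>g\<close>, so multiples of
  single words suffice, and there concatenation acts as composition.\<close>

lemma free_act_mult: "free_act D \<alpha> (f * g) x = free_act D \<alpha> f (free_act D \<alpha> g x)"
proof (induction f rule: poly_mapping_add_induct)
  case (single v a)
  show ?case
  proof (induction g rule: poly_mapping_add_induct)
    case (single w b)
    show ?case
      by (simp add: mult_single free_act_single plus_gword_def pscale_pair.linear_scale[OF word_act_linear])
  qed (simp add: distrib_left free_act_add_left free_act_add_right)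
qed (simp add: distrib_right free_act_add_left)

lemma free_act_kp_rels:
  assumes "r \<in> kp_rels L"
  shows "free_act D \<alpha> r x = 0"
proof -
  have if_0: "free_act D \<alpha> (if b then h else 0) x = (if b then free_act D \<alpha> h x else 0)" for b h
    by (simp add: free_act_zero_left)
  note act = free_act_diff_left free_act_sum_left free_act_monomial if_0
  show ?thesis
    using assms unfolding kp_rels_def
  proof (elim UnE CollectE exE conjE)
    fix f g
    assume "r = monomial [Real f, Real g]
      - (if src L f = ran L g then monomial [Real (cmp L f g)] else 0)" "f \<in> mor L" "g \<in> mor L"
    then show ?thesis by (simp only: act word_act_real_real diff_self)
  next
    fix f g
    assume "r = monomial [star L g, star L f]
      - (if src L f = ran L g then monomial [star L (cmp L f g)] else 0)" "f \<in> mor L" "g \<in> mor L"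
    then show ?thesis by (simp only: act word_act_star_star diff_self)
  next
    fix f g
    assume "r = monomial [star L f, Real g]
      - (if f = g then monomial [Real (idm L (src L f))] else 0)"
      "f \<in> mor L" "g \<in> mor L" "deg L f = deg L g"
    then show ?thesis by (simp only: act word_act_star_real diff_self)
  next
    fix v n
    assume "r = (\<Sum>f \<in> into_deg L v n. monomial [Real f, star L f]) - monomial [Real (idm L v)]"
      "v \<in> obj L"
    then show ?thesis by (simp only: act word_act_real_star_sum diff_self)
  qed
qed

lemma free_act_gen_ideal:
  assumes "r \<in> gen_ideal X (kp_rels L)"
  shows "free_act D \<alpha> r x = 0"
  using assms
  \<comment> \<open>The vector stays arbitrary because in \<open>a * f\<close> the element
    \<open>a\<close> acts on the image of \<open>x\<close> under \<open>f\<close>.\<close>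
  by (induction arbitrary: x rule: gen_ideal.induct)
    (simp_all add: free_act_kp_rels free_act_zero_left free_act_add_left free_act_pscale_left
      free_act_mult free_act_zero_right)

abbreviation "kp_cls f \<equiv> cls (kp_gens L) (kp_rels L) f"

text \<open>Representatives differ by an element of the ideal, which acts as zero, so the set of
  values in \<open>rep_act\<close> is a singleton.\<close>

lemma rep_act_cls:
  assumes "f \<in> free_alg (kp_gens L)"
  shows "rep_act D \<alpha> (kp_cls f) x = free_act D \<alpha> f x"
proof -
  have "free_act D \<alpha> g x = free_act D \<alpha> f x" if "g \<in> kp_cls f" for g
    using that free_act_gen_ideal[of "f - g" "kp_gens L" x] by (simp add: ideal_cong_def free_act_diff_left)
  moreover have "f \<in> kp_cls f"
    using assms equiv_class_self[OF equiv_ideal_cong] by blast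
  ultimately show ?thesis
    unfolding rep_act_def by (intro the_elem_image_unique) blast+
qed

lemma carr_KP: "carr (KP TYPE('c::field) L) = kp_cls ` (free_alg (kp_gens L) :: (_ \<Rightarrow>\<^sub>0 'c) set)"
  unfolding KP_def by (rule carr_presented_alg)

text \<open>The side condition handles the empty word, which also relates elements outside the
  vertex set to themselves.\<close>

lemma word_moves_obj:
  "word_moves D \<alpha> ws v u \<Longrightarrow> ws \<noteq> [] \<or> v \<in> obj D \<Longrightarrow> v \<in> obj D \<and> u \<in> obj D"
proof (induction ws arbitrary: u)
  case (Cons g ws)
  then show ?case using moves_obj by (cases "ws = []") fastforce+
qed simp

lemma word_act_rep_space:
  fixes x :: "'o \<Rightarrow>\<^sub>0 'c::field"
  assumes "x \<in> rep_space TYPE('c) D"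
  shows "word_act D \<alpha> ws x \<in> rep_space TYPE('c) D"
proof -
  have "u \<in> obj D" if u: "u \<in> Poly_Mapping.keys (word_act D \<alpha> ws x)" for u
  proof -
    obtain v where v: "word_moves D \<alpha> ws v u"
      using u lookup_word_act(2) by (metis in_keys_iff)
    then have "v \<in> Poly_Mapping.keys x" using u lookup_word_act(1) by (metis in_keys_iff)
    then show ?thesis using v assms word_moves_obj by (auto simp: rep_space_def)
  qed
  then show ?thesis by (auto simp: rep_space_def)
qed

lemma subspace_rep_space: "pscale.subspace (rep_space TYPE('c::field) D)"
  unfolding pscale.subspace_def
proof (intro conjI ballI allI)
  fix x y :: "'o \<Rightarrow>\<^sub>0 'c"
  assume "x \<in> rep_space TYPE('c) D" "y \<in> rep_space TYPE('c) D"
  then show "x + y \<in> rep_space TYPE('c) D"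
    using Poly_Mapping.keys_add[of x y] unfolding rep_space_def by blast
qed (auto simp: rep_space_def in_keys_iff subset_iff)

lemma free_act_rep_space:
  fixes x :: "'o \<Rightarrow>\<^sub>0 'c::field"
  assumes "x \<in> rep_space TYPE('c) D"
  shows "free_act D \<alpha> f x \<in> rep_space TYPE('c) D"
  unfolding free_act_def lin_ext_def[of _ f]
  by (intro pscale.subspace_sum pscale.subspace_scale subspace_rep_space word_act_rep_space assms)

lemma left_module_rep_space:
  "left_module (KP TYPE('c::field) L) pscale (rep_space TYPE('c) D) (rep_act D \<alpha>)"
proof -
  note ops = KP_def rep_act_cls free_alg_add free_alg_mult free_alg_pscale
    aadd_cls amult_cls ascale_cls
  show ?thesis
    unfolding left_module_def carr_KP ball_simps
  proof (intro conjI ballI allI)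
    fix f g :: "'n letter gword \<Rightarrow>\<^sub>0 'c" and x y :: "'o \<Rightarrow>\<^sub>0 'c" and c
    assume f: "f \<in> free_alg (kp_gens L)" and g: "g \<in> free_alg (kp_gens L)"
    show "rep_act D \<alpha> (kp_cls f) (x + y) = rep_act D \<alpha> (kp_cls f) x + rep_act D \<alpha> (kp_cls f) y"
      using f by (simp only: ops free_act_add_right)
    show "rep_act D \<alpha> (aadd (KP TYPE('c) L) (kp_cls f) (kp_cls g)) x
        = rep_act D \<alpha> (kp_cls f) x + rep_act D \<alpha> (kp_cls g) x"
      using f g by (simp only: ops free_act_add_left)
    show "rep_act D \<alpha> (amult (KP TYPE('c) L) (kp_cls f) (kp_cls g)) x
        = rep_act D \<alpha> (kp_cls f) (rep_act D \<alpha> (kp_cls g) x)"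
      using f g by (simp only: ops free_act_mult)
    show "rep_act D \<alpha> (ascale (KP TYPE('c) L) c (kp_cls f)) x = pscale c (rep_act D \<alpha> (kp_cls f) x)"
      using f by (simp only: ops free_act_pscale_left)
    show "rep_act D \<alpha> (kp_cls f) (pscale c x) = pscale c (rep_act D \<alpha> (kp_cls f) x)"
      using f by (simp only: ops free_act_pscale_right)
  qed (simp_all add: vector_space_pscale subspace_rep_space rep_act_cls free_act_rep_space)
qed

section \<open>Walks\<close>

lemma walk_edges_lift:
  assumes "moves D \<alpha> g v u" "g \<in> walk_edges L"
  obtains e where "e \<in> walk_edges D" "edge_src D e = v" "edge_ran D e = u" "map_letter (mmap \<alpha>) e = g"
proof (cases g)
  case (Real f)
  then obtain d where "d \<in> mor D" "src D d = v" "ran D d = u" "mmap \<alpha> d = f" using assms by auto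
  then show thesis using that[of "Real d"] Real by (simp add: walk_edges_def)
next
  case (Ghost f)
  then obtain d where d: "d \<in> mor D" "ran D d = v" "src D d = u" "mmap \<alpha> d = f" using assms by auto
  \<comment> \<open>Identities have no ghost edge, so \<open>d\<close> must not be one; \<alpha>
    sends identities to identities, and \<open>f\<close> is none.\<close>
  have "d \<notin> idm D ` obj D"
    using d assms(2) Ghost omap_obj mmap_idm by (auto simp: walk_edges_def)
  then show thesis using that[of "Ghost d"] Ghost d by (simp add: walk_edges_def)
qed

lemma walk_edges_push:
  assumes "e \<in> walk_edges D"
  shows "moves D \<alpha> (map_letter (mmap \<alpha>) e) (edge_src D e) (edge_ran D e)"
    and "map_letter (mmap \<alpha>) e \<in> walk_edges L"
proof -
  show "moves D \<alpha> (map_letter (mmap \<alpha>) e) (edge_src D e) (edge_ran D e)"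
    using assms by (auto simp: walk_edges_def)
  \<comment> \<open>Degrees are preserved and identities are exactly the morphisms of degree 0, so
    non-identities stay non-identities.\<close>
  have "mmap \<alpha> d \<notin> idm L ` obj L" if "d \<in> mor D" "d \<notin> idm D ` obj D" for d
    using that by (simp flip: dom.deg_eq_0_iff cod.deg_eq_0_iff add: mmap_mor mmap_deg)
  then show "map_letter (mmap \<alpha>) e \<in> walk_edges L"
    using assms by (auto simp: walk_edges_def mmap_mor)
qed

lemma walk_push:
  assumes "p \<in> walks D"
  shows "word_moves D \<alpha> (walk_map \<alpha> p) (edge_src D (last p)) (edge_ran D (hd p)) \<and>
    set (walk_map \<alpha> p) \<subseteq> walk_edges L"
  using assms
proof (induction p)
  case (Cons e p)
  then have e: "e \<in> walk_edges D" by (simp add: walks_def)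
  show ?case
  proof (cases p)
    case Nil
    then show ?thesis using walk_edges_push[OF e] by (simp add: walk_map_def)
  next
    case (Cons e' p')
    then have "p \<in> walks D" "edge_src D e = edge_ran D (hd p)" "p \<noteq> []"
      using Cons.prems by (auto simp: walks_def)
    then show ?thesis using Cons.IH walk_edges_push[OF e] by (auto simp: walk_map_def)
  qed
qed (simp add: walks_def)

text \<open>Each move along the word is an edge of \<Delta>, and consecutive edges meet at the
  intermediate vertex, so the edges chain up to a walk.\<close>

lemma walk_lift:
  assumes "word_moves D \<alpha> ws v u" "ws \<noteq> []" "set ws \<subseteq> walk_edges L"
  shows "\<exists>p \<in> walks D. edge_src D (last p) = v \<and> edge_ran D (hd p) = u \<and> walk_map \<alpha> p = ws"
  using assms
proof (induction ws arbitrary: u)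
  case (Cons g ws)
  then obtain t where t: "word_moves D \<alpha> ws v t" "moves D \<alpha> g t u" by auto
  obtain e where e: "e \<in> walk_edges D" "edge_src D e = t" "edge_ran D e = u"
      "map_letter (mmap \<alpha>) e = g"
    using walk_edges_lift[OF t(2)] Cons.prems by auto
  show ?case
  proof (cases "ws = []")
    case True
    then show ?thesis
      using e t by (intro bexI[of _ "[e]"]) (auto simp: walks_def walk_map_def)
  next
    case False
    then obtain p where p: "p \<in> walks D" "edge_src D (last p) = v" "edge_ran D (hd p) = t"
        "walk_map \<alpha> p = ws"
      using Cons.IH[OF t(1)] Cons.prems by auto
    then have "e # p \<in> walks D"
      using e by (cases p) (auto simp: walks_def)
    then show ?thesis
      using p e by (intro bexI[of _ "e # p"]) (auto simp: walk_map_def walks_def)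
  qed
qed simp

text \<open>Turns irreducibility into a statement about the action: two vertices are separated by a
  word that is defined at one of them only.\<close>

lemma walks_from_image:
  "walk_map \<alpha> ` walks_from D v = {ws. ws \<noteq> [] \<and> set ws \<subseteq> walk_edges L \<and> (\<exists>u. word_moves D \<alpha> ws v u)}"
proof (intro equalityI subsetI)
  fix ws
  assume "ws \<in> walk_map \<alpha> ` walks_from D v"
  then obtain p where p: "p \<in> walks D" "edge_src D (last p) = v" "ws = walk_map \<alpha> p"
    by (auto simp: walks_from_def)
  then have "ws \<noteq> []" by (simp add: walks_def walk_map_def)
  then show "ws \<in> {ws. ws \<noteq> [] \<and> set ws \<subseteq> walk_edges L \<and> (\<exists>u. word_moves D \<alpha> ws v u)}"
    using walk_push[OF p(1)] p(2,3) by blast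
next
  fix ws
  assume "ws \<in> {ws. ws \<noteq> [] \<and> set ws \<subseteq> walk_edges L \<and> (\<exists>u. word_moves D \<alpha> ws v u)}"
  then obtain p where "p \<in> walks D" "edge_src D (last p) = v" "walk_map \<alpha> p = ws"
    using walk_lift by blast
  then show "ws \<in> walk_map \<alpha> ` walks_from D v"
    unfolding walks_from_def by blast
qed

lemma edge_map_ends:
  assumes "e \<in> walk_edges D"
  shows "edge_src L (map_letter (mmap \<alpha>) e) = omap \<alpha> (edge_src D e)"
    "edge_ran L (map_letter (mmap \<alpha>) e) = omap \<alpha> (edge_ran D e)"
  using assms by (auto simp: walk_edges_def mmap_src mmap_ran)

lemma walk_map_walks:
  assumes "p \<in> walks D"
  shows "walk_map \<alpha> p \<in> walks L"
proof -
  have "successively (\<lambda>e e'. edge_src L e = edge_ran L e') (walk_map \<alpha> p)"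
    unfolding walk_map_def successively_map
  proof (rule successively_mono)
    show "successively (\<lambda>e e'. edge_src D e = edge_ran D e') p"
      using assms by (simp add: walks_def)
    fix e e'
    assume "e \<in> set p" "e' \<in> set p" "edge_src D e = edge_ran D e'"
    moreover from this have "e \<in> walk_edges D" "e' \<in> walk_edges D"
      using assms unfolding walks_def by blast+
    ultimately show "edge_src L (map_letter (mmap \<alpha>) e) = edge_ran L (map_letter (mmap \<alpha>) e')"
      by (simp add: edge_map_ends)
  qed
  moreover have "walk_map \<alpha> p \<noteq> []"
    using assms by (simp add: walks_def walk_map_def)
  ultimately show ?thesis
    using walk_push[OF assms] unfolding walks_def by blast
qed

text \<open>A word relating some pair of vertices lifts to a walk in \<Delta>, and \<alpha> maps
  that walk back to the word.\<close>

lemma word_moves_walks: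
  assumes "word_moves D \<alpha> ws v u" "ws \<noteq> []" "set ws \<subseteq> walk_edges L"
  shows "ws \<in> walks L"
  using walk_lift[OF assms] walk_map_walks by blast

lemma star_in_walk_edges: "f \<in> mor L \<Longrightarrow> star L f \<in> walk_edges L"
  unfolding cod.kp_gens_eq_walk_edges[symmetric] kp_gens_def by simp

lemma word_moves_connected:
  assumes "u \<in> obj D" "v \<in> obj D"
  shows "\<exists>ws. ws \<noteq> [] \<and> set ws \<subseteq> walk_edges L \<and> word_moves D \<alpha> ws u v"
  using dom.connected[OF assms]
proof (induction rule: equivclp_induct)
  case base
  \<comment> \<open>The word must be nonempty, so staying at \<open>u\<close> uses the identity
    letter.\<close>
  have "moves D \<alpha> (Real (idm L (omap \<alpha> u))) u u"
    using assms by (simp add: moves_idm omap_obj del: moves.simps)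
  then show ?case
    using assms by (intro exI[of _ "[Real (idm L (omap \<alpha> u))]"])
      (auto simp: walk_edges_def cod.idm_mor omap_obj simp del: moves.simps)
next
  case (step y z)
  then obtain ws where ws: "ws \<noteq> []" "set ws \<subseteq> walk_edges L" "word_moves D \<alpha> ws u y" by blast
  \<comment> \<open>Connectedness gives a morphism in one of two directions: the real letter serves
    one, \<open>star\<close> the other. \<open>star\<close> is an edge even when the morphism is an
    identity.\<close>
  obtain g where "g \<in> walk_edges L" "moves D \<alpha> g y z"
  proof -
    obtain d where d: "d \<in> mor D" "ran D d = y \<and> src D d = z \<or> ran D d = z \<and> src D d = y"
      using step by blast
    then have m: "mmap \<alpha> d \<in> mor L" by (simp add: mmap_mor)
    then have "star L (mmap \<alpha> d) \<in> walk_edges L" "Real (mmap \<alpha> d) \<in> walk_edges L"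
      using star_in_walk_edges by (auto simp: walk_edges_def)
    moreover have "moves D \<alpha> (star L (mmap \<alpha> d)) y z \<or> moves D \<alpha> (Real (mmap \<alpha> d)) y z"
      using d moves_star[OF m] by auto
    ultimately show thesis using that by blast
  qed
  then show ?case using ws by (intro exI[of _ "g # ws"]) auto
qed

section \<open>Simplicity and irreducibility\<close>

lemma word_act_idm:
  assumes "w \<in> obj L" "u \<in> obj D" "omap \<alpha> u = w"
  shows "Poly_Mapping.lookup (word_act D \<alpha> [Real (idm L w)] x) u = Poly_Mapping.lookup x u"
  using assms by (intro lookup_word_act(1)) (simp add: moves_idm del: moves.simps)

lemma word_act_shrinks:
  fixes x :: "'o \<Rightarrow>\<^sub>0 'c::field"
  assumes "u \<in> Poly_Mapping.keys x" "v \<in> Poly_Mapping.keys x"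
    and "word_moves D \<alpha> ws u t" "\<nexists>t. word_moves D \<alpha> ws v t"
  shows "word_act D \<alpha> ws x \<noteq> 0"
    and "card (Poly_Mapping.keys (word_act D \<alpha> ws x)) < card (Poly_Mapping.keys x)"
proof -
  show "word_act D \<alpha> ws x \<noteq> 0"
    using lookup_word_act(1)[OF assms(3)] assms(1) by (metis in_keys_iff lookup_zero)
  \<comment> \<open>Every vertex in the new support is the target of a vertex in the old one, and
    \<open>v\<close> has no target.\<close>
  have "Poly_Mapping.keys (word_act D \<alpha> ws x)
      \<subseteq> (\<lambda>s. THE t. word_moves D \<alpha> ws s t) ` (Poly_Mapping.keys x - {v})"
  proof
    fix t
    assume t: "t \<in> Poly_Mapping.keys (word_act D \<alpha> ws x)"
    then obtain s where s: "word_moves D \<alpha> ws s t"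
      using lookup_word_act(2) by (metis in_keys_iff)
    then have "s \<in> Poly_Mapping.keys x - {v}"
      using t assms(4) lookup_word_act(1) by (metis DiffI in_keys_iff singletonD)
    moreover have "(THE t. word_moves D \<alpha> ws s t) = t"
      using s word_moves_det by blast
    ultimately show "t \<in> (\<lambda>s. THE t. word_moves D \<alpha> ws s t) ` (Poly_Mapping.keys x - {v})"
      by (metis image_eqI)
  qed
  then have "card (Poly_Mapping.keys (word_act D \<alpha> ws x)) \<le> card (Poly_Mapping.keys x - {v})"
    by (simp add: surj_card_le)
  also have "\<dots> < card (Poly_Mapping.keys x)"
    using assms(2) by (intro psubset_card_mono) auto
  finally show "card (Poly_Mapping.keys (word_act D \<alpha> ws x)) < card (Poly_Mapping.keys x)" .
qed

lemma irreducible_imp_word: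
  fixes x :: "'o \<Rightarrow>\<^sub>0 'c::field"
  assumes "irreducible_rep D \<alpha>" "x \<in> rep_space TYPE('c) D" "x \<noteq> 0"
  shows "\<exists>c. \<exists>ws. ws \<noteq> [] \<and> set ws \<subseteq> walk_edges L \<and>
    pscale c (word_act D \<alpha> ws x) \<in> rep_basis TYPE('c) D"
  using assms(2,3)
proof (induction "card (Poly_Mapping.keys x)" arbitrary: x rule: less_induct)
  case less
  obtain u where u: "u \<in> Poly_Mapping.keys x" using less.prems(2) by fastforce
  then have obj: "u \<in> obj D" using less.prems(1) by (auto simp: rep_space_def)
  show ?case
  proof (cases "Poly_Mapping.keys x = {u}")
    case True
    define a where "a = Poly_Mapping.lookup x u"
    have x: "x = Poly_Mapping.single u a"
      using True by (intro poly_mapping_eqI) (auto simp: a_def lookup_single when_def in_keys_iff)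
    have "a \<noteq> 0" using u by (simp add: a_def in_keys_iff)
    \<comment> \<open>Only the coefficient remains to be normalized, but a nonempty word is
      required; this one fixes \<open>u\<close>.\<close>
    let ?ws = "[Real (idm L (omap \<alpha> u))]"
    have m: "word_moves D \<alpha> ?ws u u"
      using obj by (simp add: moves_idm omap_obj del: moves.simps)
    have "word_act D \<alpha> ?ws x = pscale a (word_act D \<alpha> ?ws (Poly_Mapping.single u 1))"
      unfolding x by (simp flip: pscale_pair.linear_scale[OF word_act_linear] del: foldr.simps)
    also have "\<dots> = x"
      unfolding word_act_single_moves[OF m] by (simp add: x)
    finally have "pscale (inverse a) (word_act D \<alpha> ?ws x) = Poly_Mapping.single u 1"
      using \<open>a \<noteq> 0\<close> by (simp add: x)
    then show ?thesis
      using obj by (intro exI[of _ "inverse a"] exI[of _ ?ws])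
        (auto simp: rep_basis_def walk_edges_def cod.idm_mor omap_obj simp del: foldr.simps)
  next
    case False
    then obtain v where v: "v \<in> Poly_Mapping.keys x" "u \<noteq> v" using u by blast
    then have "v \<in> obj D" using less.prems(1) by (auto simp: rep_space_def)
    then have "walk_map \<alpha> ` walks_from D u \<noteq> walk_map \<alpha> ` walks_from D v"
      using assms(1) obj v(2) unfolding irreducible_rep_def by blast
    \<comment> \<open>The word may be defined at \<open>u\<close> and not at \<open>v\<close> or the
      other way round; \<open>a\<close> and \<open>b\<close> name the two vertices in the right
      order.\<close>
    then obtain ws a b t where ws: "ws \<noteq> []" "set ws \<subseteq> walk_edges L" "a \<in> Poly_Mapping.keys x"
        "b \<in> Poly_Mapping.keys x" "word_moves D \<alpha> ws a t" "\<nexists>t. word_moves D \<alpha> ws b t"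
      unfolding walks_from_image using u v(1) by blast
    obtain c qs where "qs \<noteq> []" "set qs \<subseteq> walk_edges L"
        "pscale c (word_act D \<alpha> qs (word_act D \<alpha> ws x)) \<in> rep_basis TYPE('c) D"
      using less.hyps[OF word_act_shrinks(2)[OF ws(3-6)]] word_act_rep_space[OF less.prems(1)]
        word_act_shrinks(1)[OF ws(3-6)] by metis
    \<comment> \<open>\<open>ws\<close> acts first, so it stands on the right.\<close>
    then show ?thesis using ws(2) by (intro exI[of _ c] exI[of _ "qs @ ws"]) auto
  qed
qed

text \<open>Taking values in functions on \<open>unit\<close> makes the coefficient sum an instance
  of \<open>lin_ext\<close>, whose linearity is already available.\<close>

abbreviation coeff_sum :: "('o \<Rightarrow>\<^sub>0 'c::field) \<Rightarrow> (unit \<Rightarrow>\<^sub>0 'c)" where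
  "coeff_sum \<equiv> lin_ext (\<lambda>_. Poly_Mapping.single () 1)"

text \<open>If \<open>u\<close> and \<open>v\<close> carry the same walks, every element of the algebra sends \<open>u - v\<close> to a vector
  with coefficient sum \<open>0\<close>, which is therefore not a basis vector.\<close>

lemma free_act_coeff_sum:
  fixes f :: "'n letter gword \<Rightarrow>\<^sub>0 'c::field"
  assumes "f \<in> free_alg (walk_edges L)"
    and "walk_map \<alpha> ` walks_from D u = walk_map \<alpha> ` walks_from D v"
  shows "coeff_sum (free_act D \<alpha> f (Poly_Mapping.single u 1))
    = coeff_sum (free_act D \<alpha> f (Poly_Mapping.single v 1))"
proof -
  have "coeff_sum (word_act D \<alpha> (letters w) (Poly_Mapping.single u (1::'c)))
      = coeff_sum (word_act D \<alpha> (letters w) (Poly_Mapping.single v 1))"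
    if "w \<in> Poly_Mapping.keys f" for w
  proof -
    have "letters w \<noteq> []" "set (letters w) \<subseteq> walk_edges L"
      using assms(1) that by (auto simp: free_alg_def)
    then have "(\<exists>t. word_moves D \<alpha> (letters w) u t) \<longleftrightarrow> (\<exists>t. word_moves D \<alpha> (letters w) v t)"
      using assms(2) unfolding walks_from_image by blast
    then show ?thesis unfolding word_act_single by simp
  qed
  then show ?thesis
    unfolding free_act_def lin_ext_def[of _ f]
    by (simp add: pscale_pair.linear_sum[OF linear_lin_ext] lin_ext_pscale)
qed

lemma irreducible_if_basis:
  assumes "\<forall>x \<in> rep_space TYPE('c::field) D - {0}. \<exists>f \<in> free_alg (walk_edges L).
    free_act D \<alpha> f x \<in> rep_basis TYPE('c) D"
  shows "irreducible_rep D \<alpha>"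
  unfolding irreducible_rep_def
proof (intro ballI impI notI)
  fix u v
  assume uv: "u \<in> obj D" "v \<in> obj D" "u \<noteq> v"
    and eq: "walk_map \<alpha> ` walks_from D u = walk_map \<alpha> ` walks_from D v"
  let ?u = "Poly_Mapping.single u (1::'c)" and ?v = "Poly_Mapping.single v (1::'c)"
  \<comment> \<open>The test vector: its image has coefficient sum 0, while a basis vector has
    coefficient sum 1.\<close>
  have "?u - ?v \<in> rep_space TYPE('c) D"
    using uv by (intro pscale.subspace_diff[OF subspace_rep_space]) (auto simp: rep_space_def)
  moreover have "?u - ?v \<noteq> 0"
    using uv(3) by (metis eq_iff_diff_eq_0 lookup_single_eq lookup_single_not_eq zero_neq_one)
  ultimately obtain f :: "_ \<Rightarrow>\<^sub>0 'c" and t where f: "f \<in> free_alg (walk_edges L)"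
    and t: "free_act D \<alpha> f (?u - ?v) = Poly_Mapping.single t 1"
    using assms unfolding rep_basis_def by blast
  have "Poly_Mapping.single () (1::'c) = coeff_sum (free_act D \<alpha> f (?u - ?v))"
    unfolding t by simp
  also have "\<dots> = 0"
    using free_act_coeff_sum[OF f eq]
    by (simp add: free_act_diff_right pscale_pair.linear_diff[OF linear_lin_ext])
  finally show False by (simp add: single_one_nonzero)
qed

section \<open>Submodules and simplicity\<close>

lemma subspace_eq_rep_space:
  fixes W :: "('o \<Rightarrow>\<^sub>0 'c::field) set"
  assumes W: "W \<subseteq> rep_space TYPE('c) D" "pscale.subspace W"
    and inv: "\<And>f x. f \<in> free_alg (walk_edges L) \<Longrightarrow> x \<in> W \<Longrightarrow> free_act D \<alpha> f x \<in> W"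
    and b: "b \<in> W" "b \<in> rep_basis TYPE('c) D"
  shows "W = rep_space TYPE('c) D"
proof
  obtain u where u: "u \<in> obj D" "b = Poly_Mapping.single u 1"
    using b(2) by (auto simp: rep_basis_def)
  have single: "Poly_Mapping.single v 1 \<in> W" if "v \<in> obj D" for v
  proof -
    obtain ws where ws: "ws \<noteq> []" "set ws \<subseteq> walk_edges L" "word_moves D \<alpha> ws u v"
      using word_moves_connected[OF u(1) \<open>v \<in> obj D\<close>] by blast
    then have "free_act D \<alpha> (monomial ws) b = Poly_Mapping.single v 1"
      unfolding u(2) free_act_monomial by (intro word_act_single_moves)
    then show ?thesis using inv[OF monomial_in_free_alg[OF ws(1,2)] b(1)] by simp
  qed
  show "rep_space TYPE('c) D \<subseteq> W"
  proof
    fix x :: "'o \<Rightarrow>\<^sub>0 'c"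
    assume x: "x \<in> rep_space TYPE('c) D"
    \<comment> \<open>This is \<open>x\<close> expanded in the basis, all of whose vectors lie in
      \<open>W\<close>.\<close>
    have "lin_ext (\<lambda>v. Poly_Mapping.single v 1) x \<in> W"
      unfolding lin_ext_def using x
      by (intro pscale.subspace_sum pscale.subspace_scale W(2) single) (auto simp: rep_space_def)
    then show "x \<in> W" by simp
  qed
qed (rule W(1))

text \<open>In a simple module the orbit of \<open>x\<close> under the algebra is a nonzero
  submodule, hence everything, and so contains a basis vector. Conversely, a nonzero submodule
  contains a basis vector and therefore all of them.\<close>

lemma simple_iff_basis:
  "simple_module (KP TYPE('c::field) L) pscale (rep_space TYPE('c) D) (rep_act D \<alpha>)
    \<longleftrightarrow> (\<forall>x \<in> rep_space TYPE('c) D - {0}. \<exists>f \<in> free_alg (walk_edges L).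
      free_act D \<alpha> f x \<in> rep_basis TYPE('c) D)" (is "?simple \<longleftrightarrow> ?basis")
proof -
  let ?V = "rep_space TYPE('c) D" and ?A = "free_alg (walk_edges L) :: ('n letter gword \<Rightarrow>\<^sub>0 'c) set"
  have simple_iff: "?simple \<longleftrightarrow> (\<exists>f \<in> ?A. \<exists>x \<in> ?V. free_act D \<alpha> f x \<noteq> 0) \<and>
     (\<forall>W \<subseteq> ?V. pscale.subspace W \<and> (\<forall>f \<in> ?A. \<forall>x \<in> W. free_act D \<alpha> f x \<in> W) \<longrightarrow> W = {0} \<or> W = ?V)"
    unfolding simple_module_def carr_KP ball_simps bex_simps
    by (simp add: left_module_rep_space rep_act_cls flip: cod.kp_gens_eq_walk_edges)
  obtain u where u: "u \<in> obj D" using dom.nonempty by blast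
  let ?u = "Poly_Mapping.single u (1::'c)"
  have u_V: "?u \<in> ?V" "?u \<in> rep_basis TYPE('c) D" "?u \<noteq> 0"
    using u by (auto simp: rep_space_def rep_basis_def single_one_nonzero)
  show ?thesis
  proof
    assume ?simple
    show ?basis
    proof
      fix x
      assume x: "x \<in> ?V - {0}"
      let ?W = "(\<lambda>f. free_act D \<alpha> f x) ` ?A"
      have sub: "pscale.subspace ?W"
        unfolding pscale.subspace_def
      proof (intro conjI ballI allI)
        show "0 \<in> ?W"
          by (rule image_eqI[OF _ zero_in_free_alg]) (simp add: free_act_zero_left)
      next
        fix y z
        assume "y \<in> ?W" "z \<in> ?W"
        then show "y + z \<in> ?W"
          by (auto simp flip: free_act_add_left intro: free_alg_add)
      next
        fix c y
        assume "y \<in> ?W"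
        then show "pscale c y \<in> ?W"
          by (auto simp flip: free_act_pscale_left intro: free_alg_pscale)
      qed
      have inv: "\<forall>f \<in> ?A. \<forall>y \<in> ?W. free_act D \<alpha> f y \<in> ?W"
        by (auto simp flip: free_act_mult intro: free_alg_mult)
      have "?W \<subseteq> ?V" using x free_act_rep_space by blast
      moreover have "?W \<noteq> {0}"
      proof -
        have "Poly_Mapping.keys x \<noteq> {}" "Poly_Mapping.keys x \<subseteq> obj D"
          using x by (simp_all add: rep_space_def)
        then obtain v where v: "v \<in> Poly_Mapping.keys x" "v \<in> obj D" by blast
        \<comment> \<open>The free algebra has no unit to exhibit \<open>x\<close> in its own orbit.
          A vertex generator replaces it: it keeps the nonzero coefficient at
          \<open>v\<close>.\<close>
        let ?e = "monomial [Real (idm L (omap \<alpha> v))] :: 'n letter gword \<Rightarrow>\<^sub>0 'c"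
        have "?e \<in> ?A"
          using v by (intro monomial_in_free_alg) (auto simp: walk_edges_def cod.idm_mor omap_obj)
        moreover have "free_act D \<alpha> ?e x \<noteq> 0"
          unfolding free_act_monomial using v word_act_idm[of "omap \<alpha> v" v x]
          by (metis in_keys_iff lookup_zero omap_obj)
        ultimately show ?thesis by blast
      qed
      ultimately have "?W = ?V"
        using \<open>?simple\<close> sub inv unfolding simple_iff by blast
      then show "\<exists>f \<in> ?A. free_act D \<alpha> f x \<in> rep_basis TYPE('c) D"
        using u_V by (metis (no_types, lifting) imageE)
    qed
  next
    assume basis: ?basis
    \<comment> \<open>Simplicity includes a nonzero action; reaching a basis vector from
      \<open>?u\<close> provides it.\<close>
    have "\<exists>f \<in> ?A. \<exists>x \<in> ?V. free_act D \<alpha> f x \<noteq> 0"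
    proof -
      obtain f where "f \<in> ?A" "free_act D \<alpha> f ?u \<in> rep_basis TYPE('c) D"
        using basis u_V by blast
      then show ?thesis using u_V rep_basis_nonzero by blast
    qed
    moreover have "W = ?V"
      if W: "W \<subseteq> ?V" "pscale.subspace W" "\<forall>f \<in> ?A. \<forall>x \<in> W. free_act D \<alpha> f x \<in> W"
        and "W \<noteq> {0}" for W
    proof -
      from \<open>W \<noteq> {0}\<close> obtain x where "x \<in> W" "x \<noteq> 0"
        using pscale.subspace_0[OF W(2)] by blast
      then obtain f where "f \<in> ?A" "free_act D \<alpha> f x \<in> rep_basis TYPE('c) D"
        using basis W(1) by blast
      then show "W = ?V"
        using W \<open>x \<in> W\<close> by (intro subspace_eq_rep_space[where b = "free_act D \<alpha> f x"]) auto
    qed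
    ultimately show ?simple unfolding simple_iff by blast
  qed
qed

lemma rep_act_kp_monomial:
  fixes c :: "'c::field"
  assumes "ws \<noteq> []" "set ws \<subseteq> walk_edges L"
  shows "rep_act D \<alpha> (ascale (KP TYPE('c) L) c (kp_monomial TYPE('c) L ws)) x
    = pscale c (word_act D \<alpha> ws x)"
proof -
  have "(monomial ws :: _ \<Rightarrow>\<^sub>0 'c) \<in> free_alg (kp_gens L)"
    using assms by (simp add: monomial_in_free_alg cod.kp_gens_eq_walk_edges)
  then show ?thesis
    by (simp add: KP_def kp_monomial_def ascale_cls rep_act_cls free_alg_pscale
        free_act_pscale_left free_act_monomial)
qed

lemma irreducible_imp_walk:
  assumes "irreducible_rep D \<alpha>"
  shows "\<forall>x \<in> rep_space TYPE('c::field) D - {0}. \<exists>c. \<exists>p \<in> walks L.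
    rep_act D \<alpha> (ascale (KP TYPE('c) L) c (kp_monomial TYPE('c) L p)) x \<in> rep_basis TYPE('c) D"
proof
  fix x
  assume "x \<in> rep_space TYPE('c) D - {0}"
  then obtain c ws where ws: "ws \<noteq> []" "set ws \<subseteq> walk_edges L"
      "pscale c (word_act D \<alpha> ws x) \<in> rep_basis TYPE('c) D"
    using irreducible_imp_word[OF assms] by blast
  then have "word_act D \<alpha> ws x \<noteq> 0"
    using rep_basis_nonzero by fastforce
  \<comment> \<open>A word that does not kill \<open>x\<close> relates some pair of vertices and is
    therefore a walk.\<close>
  then have "ws \<in> walks L"
    using word_act_eq_0 word_moves_walks[OF _ ws(1,2)] by blast
  then show "\<exists>c. \<exists>p \<in> walks L.
      rep_act D \<alpha> (ascale (KP TYPE('c) L) c (kp_monomial TYPE('c) L p)) x \<in> rep_basis TYPE('c) D"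
    using ws by (metis rep_act_kp_monomial)
qed

lemma walk_imp_basis:
  assumes "\<forall>x \<in> rep_space TYPE('c::field) D - {0}. \<exists>c. \<exists>p \<in> walks L.
    rep_act D \<alpha> (ascale (KP TYPE('c) L) c (kp_monomial TYPE('c) L p)) x \<in> rep_basis TYPE('c) D"
  shows "\<forall>x \<in> rep_space TYPE('c) D - {0}. \<exists>f \<in> free_alg (walk_edges L).
    free_act D \<alpha> f x \<in> rep_basis TYPE('c) D"
proof
  fix x
  assume "x \<in> rep_space TYPE('c) D - {0}"
  then obtain c p where p: "p \<noteq> []" "set p \<subseteq> walk_edges L"
      "rep_act D \<alpha> (ascale (KP TYPE('c) L) c (kp_monomial TYPE('c) L p)) x \<in> rep_basis TYPE('c) D"
    using assms unfolding walks_def by blast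
  then have "free_act D \<alpha> (pscale c (monomial p)) x \<in> rep_basis TYPE('c) D"
    by (simp add: rep_act_kp_monomial free_act_pscale_left free_act_monomial)
  then show "\<exists>f \<in> free_alg (walk_edges L). free_act D \<alpha> f x \<in> rep_basis TYPE('c) D"
    using free_alg_pscale[OF monomial_in_free_alg[OF p(1,2)]] by blast
qed

lemma basis_iff_free_act:
  "(\<exists>a \<in> carr (KP TYPE('c::field) L). rep_act D \<alpha> a x \<in> rep_basis TYPE('c) D)
    \<longleftrightarrow> (\<exists>f \<in> free_alg (walk_edges L). free_act D \<alpha> f x \<in> rep_basis TYPE('c) D)"
  unfolding carr_KP by (simp add: rep_act_cls flip: cod.kp_gens_eq_walk_edges)

end

theorem theorem32:
  fixes \<Lambda> :: "('p, 'n, 'k::finite) kgraph_data"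
    and \<Delta> :: "('o, 'm, 'k) kgraph_data"
    and \<alpha> :: "('o, 'm, 'p, 'n) kgraph_map"
  assumes "std_kgraph \<Lambda>"
    and "representation_kgraph \<Delta> \<Lambda> \<alpha>"
  shows "(simple_module (KP TYPE('c::field) \<Lambda>) pscale (rep_space TYPE('c) \<Delta>) (rep_act \<Delta> \<alpha>)
          \<longleftrightarrow>
          (\<forall>x \<in> rep_space TYPE('c) \<Delta> - {0}. \<exists>a \<in> carr (KP TYPE('c) \<Lambda>).
             rep_act \<Delta> \<alpha> a x \<in> rep_basis TYPE('c) \<Delta>))
       \<and> ((\<forall>x \<in> rep_space TYPE('c) \<Delta> - {0}. \<exists>a \<in> carr (KP TYPE('c) \<Lambda>).
             rep_act \<Delta> \<alpha> a x \<in> rep_basis TYPE('c) \<Delta>)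
          \<longleftrightarrow>
          (\<forall>x \<in> rep_space TYPE('c) \<Delta> - {0}. \<exists>c. \<exists>p \<in> walks \<Lambda>.
             rep_act \<Delta> \<alpha> (ascale (KP TYPE('c) \<Lambda>) c (kp_monomial TYPE('c) \<Lambda> p)) x
               \<in> rep_basis TYPE('c) \<Delta>))
       \<and> ((\<forall>x \<in> rep_space TYPE('c) \<Delta> - {0}. \<exists>c. \<exists>p \<in> walks \<Lambda>.
             rep_act \<Delta> \<alpha> (ascale (KP TYPE('c) \<Lambda>) c (kp_monomial TYPE('c) \<Lambda> p)) x
               \<in> rep_basis TYPE('c) \<Delta>)
          \<longleftrightarrow>
          irreducible_rep \<Delta> \<alpha>)"
proof -
  interpret lam: std_kgraph \<Lambda> by fact
  interpret rep: representation_kgraph \<Delta> \<Lambda> \<alpha> by fact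
  interpret std_representation \<Delta> \<Lambda> \<alpha> by unfold_locales
  show ?thesis
    \<comment> \<open>Over representatives (i) and (ii) become the same statement; the rest is the
      cycle (iv) to (iii) to (ii) to (iv).\<close>
    unfolding basis_iff_free_act simple_iff_basis
    using irreducible_imp_walk walk_imp_basis irreducible_if_basis by blast
qed

end
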